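(* (Provable in ZF, without the axiom of choice.) Every set of reals $A \subseteq \mathbb{R}$ admits a rigid binary relation, i.e. there is a relation $R \subseteq A\times A$ such that $\langle A,R\rangle$ is rigid.
   Context: A structure $\langle A,R\rangle$ with $R$ a binary relation on $A$ is rigid if it has no nontrivial automorphisms: the only bijection $\pi:A\to A$ satisfying $a\mathrel{R}b \iff \pi(a)\mathrel{R}\pi(b)$ for all $a,b\in A$ is the identity. ZF denotes Zermelo–Fraenkel set theory without the axiom of choice. *)

theory Defs
  imports Main
begin

text \<open>
  HOL has a choice operator, so provability in ZF without choice is stated about an explicit first-order
  logic: formulas of the language of set theory, a natural deduction calculus, and the axioms of ZF.
  Variables are de Bruijn indices, and the only terms are variables.
\<close>

datatype fm =
    Mem nat nat  (infix \<open>\<^bold>\<in>\<close> 50)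
  | Eq nat nat  (infix \<open>\<^bold>=\<close> 50)
  | Fls  (\<open>\<^bold>\<bottom>\<close>)
  | Imp fm fm  (infixr \<open>\<^bold>\<longrightarrow>\<close> 25)
  | All fm

abbreviation Neg :: "fm \<Rightarrow> fm" (\<open>\<^bold>\<not> _\<close> [40] 40) where
  "\<^bold>\<not> p \<equiv> p \<^bold>\<longrightarrow> \<^bold>\<bottom>"

definition Or :: "fm \<Rightarrow> fm \<Rightarrow> fm" (infixr \<open>\<^bold>\<or>\<close> 30) where
  "(p \<^bold>\<or> q) = (\<^bold>\<not> p \<^bold>\<longrightarrow> q)"

definition And :: "fm \<Rightarrow> fm \<Rightarrow> fm" (infixr \<open>\<^bold>\<and>\<close> 35) where
  "(p \<^bold>\<and> q) = (\<^bold>\<not> (p \<^bold>\<longrightarrow> \<^bold>\<not> q))"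

definition Iff :: "fm \<Rightarrow> fm \<Rightarrow> fm" (infixr \<open>\<^bold>\<longleftrightarrow>\<close> 25) where
  "(p \<^bold>\<longleftrightarrow> q) = ((p \<^bold>\<longrightarrow> q) \<^bold>\<and> (q \<^bold>\<longrightarrow> p))"

definition Ex :: "fm \<Rightarrow> fm" where
  "Ex p = (\<^bold>\<not> All (\<^bold>\<not> p))"

text \<open>In the bounded quantifiers, the index of the bounding set is relative to the outside.\<close>

abbreviation AllIn :: "nat \<Rightarrow> fm \<Rightarrow> fm" where
  "AllIn a p \<equiv> All (0 \<^bold>\<in> Suc a \<^bold>\<longrightarrow> p)"

abbreviation ExIn :: "nat \<Rightarrow> fm \<Rightarrow> fm" where
  "ExIn a p \<equiv> Ex (0 \<^bold>\<in> Suc a \<^bold>\<and> p)"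

primrec ren :: "(nat \<Rightarrow> nat) \<Rightarrow> fm \<Rightarrow> fm" where
  "ren f (x \<^bold>\<in> y) = (f x \<^bold>\<in> f y)"
| "ren f (x \<^bold>= y) = (f x \<^bold>= f y)"
| "ren f \<^bold>\<bottom> = \<^bold>\<bottom>"
| "ren f (p \<^bold>\<longrightarrow> q) = (ren f p \<^bold>\<longrightarrow> ren f q)"
| "ren f (All p) = All (ren (case_nat 0 (\<lambda>n. Suc (f n))) p)"

text \<open>Replace variable 0 by variable \<open>x\<close> and lower all other variables by one.\<close>

definition inst :: "nat \<Rightarrow> fm \<Rightarrow> fm" where
  "inst x p = ren (case_nat x (\<lambda>n. n)) p"

text \<open>All free variables of \<open>p\<close> are below \<open>arity p\<close>.\<close>

primrec arity :: "fm \<Rightarrow> nat" where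
  "arity (x \<^bold>\<in> y) = max (Suc x) (Suc y)"
| "arity (x \<^bold>= y) = max (Suc x) (Suc y)"
| "arity \<^bold>\<bottom> = 0"
| "arity (p \<^bold>\<longrightarrow> q) = max (arity p) (arity q)"
| "arity (All p) = arity p - 1"

definition univ_closure :: "fm \<Rightarrow> fm" where
  "univ_closure p = (All ^^ arity p) p"

text \<open>
  Classical natural deduction with equality. In \<open>AllI\<close>, shifting the assumptions by one is the
  eigenvariable condition: variable 0 is not free in any shifted assumption.
\<close>

inductive provable :: "fm set \<Rightarrow> fm \<Rightarrow> bool" (infix \<open>\<turnstile>\<close> 20) where
  Assm: "p \<in> T \<Longrightarrow> T \<turnstile> p"
| ImpI: "insert p T \<turnstile> q \<Longrightarrow> T \<turnstile> (p \<^bold>\<longrightarrow> q)"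
| ImpE: "T \<turnstile> (p \<^bold>\<longrightarrow> q) \<Longrightarrow> T \<turnstile> p \<Longrightarrow> T \<turnstile> q"
| Classical: "insert (\<^bold>\<not> p) T \<turnstile> \<^bold>\<bottom> \<Longrightarrow> T \<turnstile> p"
| AllI: "ren Suc ` T \<turnstile> p \<Longrightarrow> T \<turnstile> All p"
| AllE: "T \<turnstile> All p \<Longrightarrow> T \<turnstile> inst x p"
| EqI: "T \<turnstile> (x \<^bold>= x)"
| EqE: "T \<turnstile> (x \<^bold>= y) \<Longrightarrow> T \<turnstile> inst x p \<Longrightarrow> T \<turnstile> inst y p"

text \<open>
  Tarskian semantics over a binary relation \<open>E\<close>. It is used only to record, in the lemmas below, what
  each formula says.
\<close>

primrec sat :: "('a \<Rightarrow> 'a \<Rightarrow> bool) \<Rightarrow> (nat \<Rightarrow> 'a) \<Rightarrow> fm \<Rightarrow> bool" where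
  "sat E e (x \<^bold>\<in> y) = E (e x) (e y)"
| "sat E e (x \<^bold>= y) = (e x = e y)"
| "sat E e \<^bold>\<bottom> = False"
| "sat E e (p \<^bold>\<longrightarrow> q) = (sat E e p \<longrightarrow> sat E e q)"
| "sat E e (All p) = (\<forall>a. sat E (case_nat a e) p)"

lemma sat_connectives [simp]:
  "sat E e (p \<^bold>\<or> q) \<longleftrightarrow> sat E e p \<or> sat E e q"
  "sat E e (p \<^bold>\<and> q) \<longleftrightarrow> sat E e p \<and> sat E e q"
  "sat E e (p \<^bold>\<longleftrightarrow> q) \<longleftrightarrow> (sat E e p \<longleftrightarrow> sat E e q)"
  "sat E e (Ex p) \<longleftrightarrow> (\<exists>a. sat E (case_nat a e) p)"
  by (auto simp: Or_def And_def Iff_def Ex_def)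

lemma sat_ren: "sat E e (ren f p) \<longleftrightarrow> sat E (\<lambda>n. e (f n)) p"
proof (induction p arbitrary: e f)
  case (All p)
  have "(\<lambda>n. case_nat a e (case_nat 0 (\<lambda>n. Suc (f n)) n)) = case_nat a (\<lambda>n. e (f n))" for a
    by (auto split: nat.split)
  then show ?case by (simp add: All)
qed simp_all

lemma sat_inst: "sat E e (inst x p) \<longleftrightarrow> sat E (case_nat (e x) e) p"
proof -
  have "(\<lambda>n. e (case_nat x (\<lambda>n. n) n)) = case_nat (e x) e"
    by (auto split: nat.split)
  then show ?thesis by (simp add: inst_def sat_ren)
qed

theorem soundness: "T \<turnstile> p \<Longrightarrow> \<forall>q\<in>T. sat E e q \<Longrightarrow> sat E e p"
proof (induction arbitrary: e rule: provable.induct)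
  case (AllI T p)
  then show ?case by (simp add: sat_ren)
next
  case (EqE T x y p)
  then show ?case by (metis sat.simps(2) sat_inst)
qed (auto simp: sat_inst)


section \<open>The axioms of ZF\<close>

definition extensionality :: fm where
  "extensionality = All (All (All (0 \<^bold>\<in> 2 \<^bold>\<longleftrightarrow> 0 \<^bold>\<in> 1) \<^bold>\<longrightarrow> 1 \<^bold>= 0))"

definition foundation :: fm where
  "foundation = All (Ex (0 \<^bold>\<in> 1) \<^bold>\<longrightarrow> ExIn 0 (\<^bold>\<not> Ex (0 \<^bold>\<in> 2 \<^bold>\<and> 0 \<^bold>\<in> 1)))"

definition pairing :: fm where
  "pairing = All (All (Ex (All (0 \<^bold>\<in> 1 \<^bold>\<longleftrightarrow> 0 \<^bold>= 3 \<^bold>\<or> 0 \<^bold>= 2))))"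

definition union :: fm where
  "union = All (Ex (All (0 \<^bold>\<in> 1 \<^bold>\<longleftrightarrow> ExIn 2 (1 \<^bold>\<in> 0))))"

definition power_set :: fm where
  "power_set = All (Ex (All (0 \<^bold>\<in> 1 \<^bold>\<longleftrightarrow> AllIn 0 (0 \<^bold>\<in> 3))))"

definition infinity :: fm where
  "infinity = Ex (ExIn 0 (All (\<^bold>\<not> 0 \<^bold>\<in> 1)) \<^bold>\<and>
                  AllIn 0 (ExIn 1 (All (0 \<^bold>\<in> 1 \<^bold>\<longleftrightarrow> 0 \<^bold>\<in> 2 \<^bold>\<or> 0 \<^bold>= 2))))"

text \<open>
  In \<open>separation p\<close>, variable 0 of \<open>p\<close> is the element, variable 1 is the given set, and the others are
  parameters. In \<open>replacement p\<close>, variable 0 of \<open>p\<close> is the value, variable 1 is the argument, and the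
  others are parameters. The renamings skip the bound variables that \<open>p\<close> must not mention.
\<close>

definition separation :: "fm \<Rightarrow> fm" where
  "separation p = univ_closure
     (All (Ex (All (0 \<^bold>\<in> 1 \<^bold>\<longleftrightarrow> 0 \<^bold>\<in> 2 \<^bold>\<and> ren (case_nat 0 (\<lambda>n. n + 2)) p))))"

definition replacement :: "fm \<Rightarrow> fm" where
  "replacement p = univ_closure
     (All (All (All (ren (case_nat 1 (case_nat 2 (\<lambda>n. n + 3))) p \<^bold>\<and>
                     ren (case_nat 0 (case_nat 2 (\<lambda>n. n + 3))) p \<^bold>\<longrightarrow> 1 \<^bold>= 0))) \<^bold>\<longrightarrow>
      All (Ex (All (0 \<^bold>\<in> 1 \<^bold>\<longleftrightarrow>
                    ExIn 2 (ren (case_nat 1 (case_nat 0 (\<lambda>n. n + 4))) p)))))"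

definition ZF :: "fm set" where
  "ZF = {extensionality, foundation, pairing, union, power_set, infinity}
        \<union> range separation \<union> range replacement"

lemma sat_extensionality:
  "sat E e extensionality \<longleftrightarrow> (\<forall>x y. (\<forall>z. E z x \<longleftrightarrow> E z y) \<longrightarrow> x = y)"
  by (simp add: extensionality_def eval_nat_numeral)

lemma sat_foundation:
  "sat E e foundation \<longleftrightarrow> (\<forall>x. (\<exists>y. E y x) \<longrightarrow> (\<exists>y. E y x \<and> \<not> (\<exists>z. E z x \<and> E z y)))"
  by (simp add: foundation_def eval_nat_numeral)

lemma sat_pairing:
  "sat E e pairing \<longleftrightarrow> (\<forall>x y. \<exists>z. \<forall>w. E w z \<longleftrightarrow> w = x \<or> w = y)"
  by (simp add: pairing_def eval_nat_numeral)

lemma sat_union: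
  "sat E e union \<longleftrightarrow> (\<forall>x. \<exists>u. \<forall>z. E z u \<longleftrightarrow> (\<exists>y. E y x \<and> E z y))"
  by (simp add: union_def eval_nat_numeral)

lemma sat_power_set:
  "sat E e power_set \<longleftrightarrow> (\<forall>x. \<exists>u. \<forall>y. E y u \<longleftrightarrow> (\<forall>z. E z y \<longrightarrow> E z x))"
  by (simp add: power_set_def eval_nat_numeral)

lemma sat_infinity:
  "sat E e infinity \<longleftrightarrow>
    (\<exists>x. (\<exists>y. E y x \<and> (\<forall>z. \<not> E z y)) \<and>
         (\<forall>y. E y x \<longrightarrow> (\<exists>s. E s x \<and> (\<forall>z. E z s \<longleftrightarrow> E z y \<or> z = y))))"
  by (simp add: infinity_def eval_nat_numeral)

lemma sat_All_funpow:
  "sat E e ((All ^^ n) p) \<longleftrightarrow> (\<forall>e'. (\<forall>k. e' (n + k) = e k) \<longrightarrow> sat E e' p)"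
proof (induction n arbitrary: e)
  case 0
  have "(\<forall>k. e' k = e k) \<longleftrightarrow> e' = e" for e' by auto
  then show ?case by simp
next
  case (Suc n)
  have "(\<exists>a. \<forall>k. e' (n + k) = case_nat a e k) \<longleftrightarrow> (\<forall>k. e' (Suc n + k) = e k)" for e'
  proof
    assume "\<exists>a. \<forall>k. e' (n + k) = case_nat a e k"
    then obtain a where a: "\<And>k. e' (n + k) = case_nat a e k" by blast
    show "\<forall>k. e' (Suc n + k) = e k" using a[of "Suc k" for k] by simp
  next
    assume "\<forall>k. e' (Suc n + k) = e k"
    then have "\<forall>k. e' (n + k) = case_nat (e' n) e k" by (auto split: nat.split)
    then show "\<exists>a. \<forall>k. e' (n + k) = case_nat a e k" ..
  qed
  then show ?case by (simp add: Suc.IH) metis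
qed

lemma sat_cong_arity: "(\<forall>n < arity p. e n = e' n) \<Longrightarrow> sat E e p \<longleftrightarrow> sat E e' p"
proof (induction p arbitrary: e e')
  case (All p)
  have "sat E (case_nat a e) p \<longleftrightarrow> sat E (case_nat a e') p" for a
    by (rule All.IH) (use All.prems in \<open>auto split: nat.split\<close>)
  then show ?case by simp
next
  case (Imp p q)
  have "sat E e p \<longleftrightarrow> sat E e' p" "sat E e q \<longleftrightarrow> sat E e' q"
    using Imp.prems by (auto intro!: Imp.IH)
  then show ?case by simp
qed auto

lemma sat_univ_closure: "sat E e (univ_closure p) \<longleftrightarrow> (\<forall>e. sat E e p)"
proof -
  have "sat E f p" if "sat E e (univ_closure p)" for f
  proof -
    let ?g = "\<lambda>n. if n < arity p then f n else e (n - arity p)"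
    have "sat E ?g p" using that by (simp add: univ_closure_def sat_All_funpow)
    then show ?thesis using sat_cong_arity[of p ?g f E] by simp
  qed
  then show ?thesis by (auto simp: univ_closure_def sat_All_funpow)
qed

lemma sat_separation:
  "sat E e (separation p) \<longleftrightarrow>
    (\<forall>e a. \<exists>b. \<forall>x. E x b \<longleftrightarrow> E x a \<and> sat E (case_nat x (case_nat a e)) p)"
proof -
  have 1: "(\<lambda>n. case_nat x (case_nat b (case_nat a e)) (case_nat 0 (\<lambda>n. n + 2) n))
          = case_nat x (case_nat a e)" for x b a and e :: "nat \<Rightarrow> 'a"
    by (auto split: nat.split)
  show ?thesis
    unfolding separation_def sat_univ_closure
    by (simp only: sat.simps sat_connectives sat_ren 1) (simp add: eval_nat_numeral)
qed

lemma sat_replacement: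
  "sat E e (replacement p) \<longleftrightarrow>
    (\<forall>e. (\<forall>x y z. sat E (case_nat y (case_nat x e)) p \<and> sat E (case_nat z (case_nat x e)) p
                   \<longrightarrow> y = z) \<longrightarrow>
         (\<forall>a. \<exists>b. \<forall>y. E y b \<longleftrightarrow> (\<exists>x. E x a \<and> sat E (case_nat y (case_nat x e)) p)))"
proof -
  have 1: "(\<lambda>n. case_nat z (case_nat y (case_nat x e)) (case_nat 1 (case_nat 2 (\<lambda>n. n + 3)) n))
          = case_nat y (case_nat x e)" for x y z and e :: "nat \<Rightarrow> 'a"
    by (auto split: nat.split simp: eval_nat_numeral)
  have 2: "(\<lambda>n. case_nat z (case_nat y (case_nat x e)) (case_nat 0 (case_nat 2 (\<lambda>n. n + 3)) n))
          = case_nat z (case_nat x e)" for x y z and e :: "nat \<Rightarrow> 'a"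
    by (auto split: nat.split simp: eval_nat_numeral)
  have 3: "(\<lambda>n. case_nat x (case_nat y (case_nat b (case_nat a e)))
              (case_nat 1 (case_nat 0 (\<lambda>n. n + 4)) n))
          = case_nat y (case_nat x e)" for x y a b and e :: "nat \<Rightarrow> 'a"
    by (auto split: nat.split simp: eval_nat_numeral)
  have 4: "case_nat x (case_nat y (case_nat b (case_nat a e))) 3 = a"
    "case_nat y (case_nat b (case_nat a e)) 2 = a" for x y a b and e :: "nat \<Rightarrow> 'a"
    by (simp_all add: eval_nat_numeral)
  show ?thesis
    unfolding replacement_def sat_univ_closure
    by (simp only: sat.simps sat_connectives sat_ren 1 2 3) (simp add: 4)
qed


section \<open>Relations and functions as sets of Kuratowski pairs\<close>

definition upair_fm :: "nat \<Rightarrow> nat \<Rightarrow> nat \<Rightarrow> fm" where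
  "upair_fm x y z = All (0 \<^bold>\<in> z + 1 \<^bold>\<longleftrightarrow> 0 \<^bold>= x + 1 \<^bold>\<or> 0 \<^bold>= y + 1)"

definition pair_fm :: "nat \<Rightarrow> nat \<Rightarrow> nat \<Rightarrow> fm" where
  "pair_fm x y z = Ex (Ex (upair_fm (x + 2) (x + 2) 1 \<^bold>\<and> upair_fm (x + 2) (y + 2) 0 \<^bold>\<and>
                           upair_fm 1 0 (z + 2)))"

definition rel_fm :: "nat \<Rightarrow> nat \<Rightarrow> nat \<Rightarrow> fm" where
  "rel_fm r x y = ExIn r (pair_fm (x + 1) (y + 1) 0)"

definition op_fm :: "nat \<Rightarrow> nat \<Rightarrow> nat \<Rightarrow> nat \<Rightarrow> fm" where
  "op_fm f x y z = Ex (pair_fm (x + 1) (y + 1) 0 \<^bold>\<and> rel_fm (f + 1) 0 (z + 1))"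

definition is_pair :: "('a \<Rightarrow> 'a \<Rightarrow> bool) \<Rightarrow> 'a \<Rightarrow> 'a \<Rightarrow> 'a \<Rightarrow> bool" where
  "is_pair E x y z \<longleftrightarrow>
    (\<exists>u v. (\<forall>w. E w u \<longleftrightarrow> w = x) \<and> (\<forall>w. E w v \<longleftrightarrow> w = x \<or> w = y) \<and> (\<forall>w. E w z \<longleftrightarrow> w = u \<or> w = v))"

definition is_rel :: "('a \<Rightarrow> 'a \<Rightarrow> bool) \<Rightarrow> 'a \<Rightarrow> 'a \<Rightarrow> 'a \<Rightarrow> bool" where
  "is_rel E r x y \<longleftrightarrow> (\<exists>p. E p r \<and> is_pair E x y p)"

definition is_op :: "('a \<Rightarrow> 'a \<Rightarrow> bool) \<Rightarrow> 'a \<Rightarrow> 'a \<Rightarrow> 'a \<Rightarrow> 'a \<Rightarrow> bool" where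
  "is_op E f x y z \<longleftrightarrow> (\<exists>t. is_pair E x y t \<and> is_rel E f t z)"

lemma sat_upair [simp]:
  "sat E e (upair_fm x y z) \<longleftrightarrow> (\<forall>w. E w (e z) \<longleftrightarrow> w = e x \<or> w = e y)"
  by (simp add: upair_fm_def)

lemma sat_pair [simp]: "sat E e (pair_fm x y z) \<longleftrightarrow> is_pair E (e x) (e y) (e z)"
  by (simp add: pair_fm_def is_pair_def eval_nat_numeral)

lemma sat_rel [simp]: "sat E e (rel_fm r x y) \<longleftrightarrow> is_rel E (e r) (e x) (e y)"
  by (simp add: rel_fm_def is_rel_def)

lemma sat_op [simp]: "sat E e (op_fm f x y z) \<longleftrightarrow> is_op E (e f) (e x) (e y) (e z)"
  by (simp add: op_fm_def is_op_def)

definition subset_fm :: "nat \<Rightarrow> nat \<Rightarrow> fm" where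
  "subset_fm a b = AllIn a (0 \<^bold>\<in> b + 1)"

definition relation_on_fm :: "nat \<Rightarrow> nat \<Rightarrow> fm" where
  "relation_on_fm r a = AllIn r (ExIn (a + 1) (ExIn (a + 2) (pair_fm 1 0 2)))"

definition bij_fm :: "nat \<Rightarrow> nat \<Rightarrow> fm" where
  "bij_fm f a =
    (relation_on_fm f a \<^bold>\<and>
     AllIn a (Ex (All (rel_fm (f + 3) 2 0 \<^bold>\<longleftrightarrow> 0 \<^bold>= 1))) \<^bold>\<and>
     AllIn a (AllIn (a + 1) (All (rel_fm (f + 3) 2 0 \<^bold>\<and> rel_fm (f + 3) 1 0 \<^bold>\<longrightarrow> 2 \<^bold>= 1))) \<^bold>\<and>
     AllIn a (ExIn (a + 1) (rel_fm (f + 2) 0 1)))"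

definition automorphism_fm :: "nat \<Rightarrow> nat \<Rightarrow> nat \<Rightarrow> fm" where
  "automorphism_fm f a r =
    (bij_fm f a \<^bold>\<and>
     AllIn a (AllIn (a + 1) (All (All (rel_fm (f + 4) 3 1 \<^bold>\<and> rel_fm (f + 4) 2 0 \<^bold>\<longrightarrow>
       (rel_fm (r + 4) 3 2 \<^bold>\<longleftrightarrow> rel_fm (r + 4) 1 0))))))"

definition rigid_fm :: "nat \<Rightarrow> nat \<Rightarrow> fm" where
  "rigid_fm a r = All (automorphism_fm 0 (a + 1) (r + 1) \<^bold>\<longrightarrow> AllIn (a + 1) (rel_fm 1 0 0))"

lemma sat_subset:
  "sat E e (subset_fm a b) \<longleftrightarrow>
    (\<forall>x. E x (e a) \<longrightarrow> E x (e b))"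
  by (simp add: subset_fm_def)

lemma sat_relation_on:
  "sat E e (relation_on_fm r a) \<longleftrightarrow>
    (\<forall>p. E p (e r) \<longrightarrow> (\<exists>x. E x (e a) \<and> (\<exists>y. E y (e a) \<and> is_pair E x y p)))"
  by (simp add: relation_on_fm_def eval_nat_numeral)

lemma sat_bij:
  "sat E e (bij_fm f a) \<longleftrightarrow>
    sat E e (relation_on_fm f a) \<and>
    (\<forall>x. E x (e a) \<longrightarrow> (\<exists>y. \<forall>w. is_rel E (e f) x w \<longleftrightarrow> w = y)) \<and>
    (\<forall>x y z. E x (e a) \<and> E y (e a) \<and> is_rel E (e f) x z \<and> is_rel E (e f) y z \<longrightarrow> x = y) \<and>
    (\<forall>y. E y (e a) \<longrightarrow> (\<exists>x. E x (e a) \<and> is_rel E (e f) x y))"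
  by (simp add: bij_fm_def eval_nat_numeral imp_conjL)

lemma sat_automorphism:
  "sat E e (automorphism_fm f a r) \<longleftrightarrow>
    sat E e (bij_fm f a) \<and>
    (\<forall>x y u v. E x (e a) \<and> E y (e a) \<and> is_rel E (e f) x u \<and> is_rel E (e f) y v \<longrightarrow>
       (is_rel E (e r) x y \<longleftrightarrow> is_rel E (e r) u v))"
  by (simp add: automorphism_fm_def eval_nat_numeral imp_conjL)

lemma sat_rigid:
  "sat E e (rigid_fm a r) \<longleftrightarrow>
    (\<forall>f. sat E (case_nat f e) (automorphism_fm 0 (a + 1) (r + 1)) \<longrightarrow>
         (\<forall>x. E x (e a) \<longrightarrow> is_rel E f x x))"
  by (simp add: rigid_fm_def)


section \<open>Complete ordered fields\<close>

definition binop_fm :: "nat \<Rightarrow> nat \<Rightarrow> fm" where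
  "binop_fm f F =
    (AllIn f (ExIn (F + 1) (ExIn (F + 2) (ExIn (F + 3) (Ex (pair_fm 3 2 0 \<^bold>\<and> pair_fm 0 1 4))))) \<^bold>\<and>
     AllIn F (AllIn (F + 1) (Ex (All (op_fm (f + 4) 3 2 0 \<^bold>\<longleftrightarrow> 0 \<^bold>= 1)))))"

definition assoc_fm :: "nat \<Rightarrow> nat \<Rightarrow> fm" where
  "assoc_fm f F =
    AllIn F (AllIn (F + 1) (AllIn (F + 2) (ExIn (F + 3) (ExIn (F + 4) (ExIn (F + 5)
      (op_fm (f + 6) 5 4 2 \<^bold>\<and> op_fm (f + 6) 4 3 1 \<^bold>\<and>
       op_fm (f + 6) 2 3 0 \<^bold>\<and> op_fm (f + 6) 5 1 0))))))"

definition comm_fm :: "nat \<Rightarrow> nat \<Rightarrow> fm" where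
  "comm_fm f F =
    AllIn F (AllIn (F + 1) (AllIn (F + 2) (op_fm (f + 3) 2 1 0 \<^bold>\<longrightarrow> op_fm (f + 3) 1 2 0)))"

definition neutral_fm :: "nat \<Rightarrow> nat \<Rightarrow> nat \<Rightarrow> fm" where
  "neutral_fm f F c = AllIn F (op_fm (f + 1) (c + 1) 0 0)"

definition distrib_fm :: "nat \<Rightarrow> nat \<Rightarrow> nat \<Rightarrow> fm" where
  "distrib_fm p m F =
    AllIn F (AllIn (F + 1) (AllIn (F + 2)
      (ExIn (F + 3) (ExIn (F + 4) (ExIn (F + 5) (ExIn (F + 6)
        (op_fm (p + 7) 5 4 3 \<^bold>\<and> op_fm (m + 7) 6 3 2 \<^bold>\<and>
         op_fm (m + 7) 6 5 1 \<^bold>\<and> op_fm (m + 7) 6 4 0 \<^bold>\<and> op_fm (p + 7) 1 0 2)))))))"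

definition field_fm :: "nat \<Rightarrow> nat \<Rightarrow> nat \<Rightarrow> nat \<Rightarrow> nat \<Rightarrow> fm" where
  "field_fm F p m z u =
    (z \<^bold>\<in> F \<^bold>\<and> u \<^bold>\<in> F \<^bold>\<and> \<^bold>\<not> z \<^bold>= u \<^bold>\<and>
     binop_fm p F \<^bold>\<and> assoc_fm p F \<^bold>\<and> comm_fm p F \<^bold>\<and> neutral_fm p F z \<^bold>\<and>
     AllIn F (ExIn (F + 1) (op_fm (p + 2) 1 0 (z + 2))) \<^bold>\<and>
     binop_fm m F \<^bold>\<and> assoc_fm m F \<^bold>\<and> comm_fm m F \<^bold>\<and> neutral_fm m F u \<^bold>\<and>
     AllIn F (\<^bold>\<not> 0 \<^bold>= z + 1 \<^bold>\<longrightarrow> ExIn (F + 1) (op_fm (m + 2) 1 0 (u + 2))) \<^bold>\<and>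
     distrib_fm p m F)"

definition linorder_fm :: "nat \<Rightarrow> nat \<Rightarrow> fm" where
  "linorder_fm F l =
    (relation_on_fm l F \<^bold>\<and>
     AllIn F (\<^bold>\<not> rel_fm (l + 1) 0 0) \<^bold>\<and>
     AllIn F (AllIn (F + 1) (AllIn (F + 2)
       (rel_fm (l + 3) 2 1 \<^bold>\<and> rel_fm (l + 3) 1 0 \<^bold>\<longrightarrow> rel_fm (l + 3) 2 0))) \<^bold>\<and>
     AllIn F (AllIn (F + 1) (rel_fm (l + 2) 1 0 \<^bold>\<or> 1 \<^bold>= 0 \<^bold>\<or> rel_fm (l + 2) 0 1)))"

definition ordered_field_fm :: "nat \<Rightarrow> nat \<Rightarrow> nat \<Rightarrow> nat \<Rightarrow> nat \<Rightarrow> nat \<Rightarrow> fm" where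
  "ordered_field_fm F p m z u l =
    (field_fm F p m z u \<^bold>\<and> linorder_fm F l \<^bold>\<and>
     AllIn F (AllIn (F + 1) (AllIn (F + 2) (AllIn (F + 3) (AllIn (F + 4)
       (rel_fm (l + 5) 4 3 \<^bold>\<and> op_fm (p + 5) 4 2 1 \<^bold>\<and> op_fm (p + 5) 3 2 0 \<^bold>\<longrightarrow>
        rel_fm (l + 5) 1 0))))) \<^bold>\<and>
     AllIn F (AllIn (F + 1) (AllIn (F + 2)
       (rel_fm (l + 3) (z + 3) 2 \<^bold>\<and> rel_fm (l + 3) (z + 3) 1 \<^bold>\<and> op_fm (m + 3) 2 1 0 \<^bold>\<longrightarrow>
        rel_fm (l + 3) (z + 3) 0))))"

definition upper_bound_fm :: "nat \<Rightarrow> nat \<Rightarrow> nat \<Rightarrow> fm" where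
  "upper_bound_fm l s b = AllIn s (rel_fm (l + 1) 0 (b + 1) \<^bold>\<or> 0 \<^bold>= b + 1)"

definition complete_fm :: "nat \<Rightarrow> nat \<Rightarrow> fm" where
  "complete_fm F l =
    All (subset_fm 0 (F + 1) \<^bold>\<and> Ex (0 \<^bold>\<in> 1) \<^bold>\<and> ExIn (F + 1) (upper_bound_fm (l + 2) 1 0) \<^bold>\<longrightarrow>
      ExIn (F + 1) (upper_bound_fm (l + 2) 1 0 \<^bold>\<and>
        AllIn (F + 2) (upper_bound_fm (l + 3) 2 0 \<^bold>\<longrightarrow> rel_fm (l + 3) 1 0 \<^bold>\<or> 1 \<^bold>= 0)))"

lemma sat_binop:
  "sat E e (binop_fm f F) \<longleftrightarrow>
    (\<forall>q. E q (e f) \<longrightarrow> (\<exists>x y z t. E x (e F) \<and> E y (e F) \<and> E z (e F) \<and>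
       is_pair E x y t \<and> is_pair E t z q)) \<and>
    (\<forall>x y. E x (e F) \<and> E y (e F) \<longrightarrow> (\<exists>z. \<forall>w. is_op E (e f) x y w \<longleftrightarrow> w = z))"
  by (simp add: binop_fm_def eval_nat_numeral imp_conjL)

lemma sat_assoc:
  "sat E e (assoc_fm f F) \<longleftrightarrow>
    (\<forall>x y z. E x (e F) \<and> E y (e F) \<and> E z (e F) \<longrightarrow>
       (\<exists>xy yz w. E xy (e F) \<and> E yz (e F) \<and> E w (e F) \<and>
          is_op E (e f) x y xy \<and> is_op E (e f) y z yz \<and>
          is_op E (e f) xy z w \<and> is_op E (e f) x yz w))"
  by (simp add: assoc_fm_def eval_nat_numeral imp_conjL)

lemma sat_comm:
  "sat E e (comm_fm f F) \<longleftrightarrow>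
    (\<forall>x y z. E x (e F) \<and> E y (e F) \<and> E z (e F) \<and> is_op E (e f) x y z \<longrightarrow> is_op E (e f) y x z)"
  by (simp add: comm_fm_def eval_nat_numeral imp_conjL)

lemma sat_neutral:
  "sat E e (neutral_fm f F c) \<longleftrightarrow>
    (\<forall>x. E x (e F) \<longrightarrow> is_op E (e f) (e c) x x)"
  by (simp add: neutral_fm_def)

lemma sat_distrib:
  "sat E e (distrib_fm p m F) \<longleftrightarrow>
    (\<forall>x y z. E x (e F) \<and> E y (e F) \<and> E z (e F) \<longrightarrow>
       (\<exists>s t u v. E s (e F) \<and> E t (e F) \<and> E u (e F) \<and> E v (e F) \<and>
          is_op E (e p) y z s \<and> is_op E (e m) x s t \<and>
          is_op E (e m) x y u \<and> is_op E (e m) x z v \<and> is_op E (e p) u v t))"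
  by (simp add: distrib_fm_def eval_nat_numeral imp_conjL)

lemma sat_field:
  "sat E e (field_fm F p m z u) \<longleftrightarrow>
    E (e z) (e F) \<and> E (e u) (e F) \<and> e z \<noteq> e u \<and>
    sat E e (binop_fm p F) \<and> sat E e (assoc_fm p F) \<and> sat E e (comm_fm p F) \<and>
    sat E e (neutral_fm p F z) \<and>
    (\<forall>x. E x (e F) \<longrightarrow> (\<exists>y. E y (e F) \<and> is_op E (e p) x y (e z))) \<and>
    sat E e (binop_fm m F) \<and> sat E e (assoc_fm m F) \<and> sat E e (comm_fm m F) \<and>
    sat E e (neutral_fm m F u) \<and>
    (\<forall>x. E x (e F) \<and> x \<noteq> e z \<longrightarrow> (\<exists>y. E y (e F) \<and> is_op E (e m) x y (e u))) \<and>
    sat E e (distrib_fm p m F)"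
  by (simp add: field_fm_def eval_nat_numeral imp_conjL)

lemma sat_linorder:
  "sat E e (linorder_fm F l) \<longleftrightarrow>
    sat E e (relation_on_fm l F) \<and>
    (\<forall>x. E x (e F) \<longrightarrow> \<not> is_rel E (e l) x x) \<and>
    (\<forall>x y z. E x (e F) \<and> E y (e F) \<and> E z (e F) \<and>
       is_rel E (e l) x y \<and> is_rel E (e l) y z \<longrightarrow> is_rel E (e l) x z) \<and>
    (\<forall>x y. E x (e F) \<and> E y (e F) \<longrightarrow> is_rel E (e l) x y \<or> x = y \<or> is_rel E (e l) y x)"
  by (simp add: linorder_fm_def eval_nat_numeral imp_conjL)

lemma sat_ordered_field:
  "sat E e (ordered_field_fm F p m z u l) \<longleftrightarrow>
    sat E e (field_fm F p m z u) \<and> sat E e (linorder_fm F l) \<and>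
    (\<forall>x y c s t. E x (e F) \<and> E y (e F) \<and> E c (e F) \<and> E s (e F) \<and> E t (e F) \<and>
       is_rel E (e l) x y \<and> is_op E (e p) x c s \<and> is_op E (e p) y c t \<longrightarrow> is_rel E (e l) s t) \<and>
    (\<forall>x y s. E x (e F) \<and> E y (e F) \<and> E s (e F) \<and>
       is_rel E (e l) (e z) x \<and> is_rel E (e l) (e z) y \<and> is_op E (e m) x y s \<longrightarrow>
       is_rel E (e l) (e z) s)"
  by (simp add: ordered_field_fm_def eval_nat_numeral imp_conjL)

lemma sat_upper_bound:
  "sat E e (upper_bound_fm l s b) \<longleftrightarrow>
    (\<forall>x. E x (e s) \<longrightarrow> is_rel E (e l) x (e b) \<or> x = e b)"
  by (simp add: upper_bound_fm_def imp_conjL)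

lemma sat_complete:
  "sat E e (complete_fm F l) \<longleftrightarrow>
    (\<forall>s. (\<forall>x. E x s \<longrightarrow> E x (e F)) \<and> (\<exists>x. E x s) \<and>
         (\<exists>b. E b (e F) \<and> (\<forall>x. E x s \<longrightarrow> is_rel E (e l) x b \<or> x = b)) \<longrightarrow>
         (\<exists>b. E b (e F) \<and> (\<forall>x. E x s \<longrightarrow> is_rel E (e l) x b \<or> x = b) \<and>
            (\<forall>c. E c (e F) \<and> (\<forall>x. E x s \<longrightarrow> is_rel E (e l) x c \<or> x = c) \<longrightarrow>
               is_rel E (e l) b c \<or> b = c)))"
  by (simp add: complete_fm_def sat_subset sat_upper_bound eval_nat_numeral imp_conjL)

text \<open>
  \<open>reals_fm F\<close> says that \<open>F\<close> is the carrier of a complete ordered field; this determines the real field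
  up to isomorphism, independently of how the reals are constructed.
\<close>

definition reals_fm :: "nat \<Rightarrow> fm" where
  "reals_fm F =
    Ex (Ex (Ex (Ex (Ex (ordered_field_fm (F + 5) 4 3 2 1 0 \<^bold>\<and> complete_fm (F + 5) 0)))))"

definition sets_of_reals_admit_rigid_relations :: fm where
  "sets_of_reals_admit_rigid_relations =
    All (reals_fm 0 \<^bold>\<longrightarrow>
      All (subset_fm 0 1 \<^bold>\<longrightarrow> Ex (relation_on_fm 0 1 \<^bold>\<and> rigid_fm 1 0)))"

end

theory Submission
  imports Defs "HOL-Library.Countable"
begin

text \<open>
  By Henkin's completeness theorem it suffices to argue in an arbitrary model of ZF.

  Let \<open>A\<close> be a set of reals. If every automorphism of \<open>A\<close> with its order is trivial, the order is the
  required relation. Otherwise some order automorphism \<open>\<phi>\<close> moves a point \<open>a\<close>, so the orbit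
  \<open>Z = {a, \<phi> a, \<phi> (\<phi> a), \<dots>}\<close> is infinite and \<open>\<langle>Z, \<phi>\<rangle>\<close> is a rigid copy of the natural numbers with
  successor. Every real is determined by a subset of \<open>Z\<close>: the times at which its iterates under the map
  \<open>x \<mapsto> x + u\<close> for \<open>x < 0\<close>, \<open>x \<mapsto> - 2 x\<close> for \<open>x \<ge> 0\<close> are negative, where \<open>u > 0\<close> is fixed. Attaching
  these subsets to the points outside \<open>Z\<close> pins down all of \<open>A\<close>.
\<close>

section \<open>Completeness of the calculus\<close>

text \<open>In ZF an infinite set of reals need not have a countably infinite subset, so the points
  that carry the codes cannot simply be chosen from \<open>A\<close>. The case distinction supplies
  them: failure of rigidity of the order is itself an order automorphism, and by strict monotonicity
  a point that it moves never recurs. Binary expansions would need integers and division inside the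
  model. The itinerary map needs only order and addition: a point between zero and \<open>u\<close>
  goes to minus its double and is back after at most two additions of \<open>u\<close>, so the
  difference of two points with equal itineraries is multiplied by -2 on each passage, and a bounded
  interval leaves no room for that. The model may be nonstandard. Completeness of the field and
  induction along \<open>Z\<close> then hold only for sets that belong to the model, so every set
  they are applied to must be definable with parameters. Hence functions appear as graphs, iteration
  appears as a least closed relation, and a calculus of definable predicates precedes the
  mathematics.\<close>

abbreviation lift_ren :: "(nat \<Rightarrow> nat) \<Rightarrow> nat \<Rightarrow> nat" where
  "lift_ren f \<equiv> case_nat 0 (\<lambda>n. Suc (f n))"

section \<open>Renaming and instantiation of variables\<close>

lemma ren_cong_arity: "(\<And>n. n < arity p \<Longrightarrow> f n = g n) \<Longrightarrow> ren f p = ren g p"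
proof (induction p arbitrary: f g)
  case (All p)
  have "ren (lift_ren f) p = ren (lift_ren g) p"
    by (rule All.IH) (use All.prems in \<open>auto split: nat.split\<close>)
  then show ?case by simp
next
  case (Imp p q)
  have "ren f p = ren g p" "ren f q = ren g q"
    using Imp.prems by (auto intro!: Imp.IH)
  then show ?case by simp
qed auto

lemma ren_id [simp]: "ren (\<lambda>n. n) p = p"
proof (induction p)
  case (All p)
  have "lift_ren (\<lambda>n. n) = (\<lambda>n. n)" by (auto split: nat.split)
  then show ?case using All by simp
qed auto

lemma ren_ren: "ren f (ren g p) = ren (\<lambda>n. f (g n)) p"
proof (induction p arbitrary: f g)
  case (All p)
  have "(\<lambda>n. lift_ren f (lift_ren g n)) = lift_ren (\<lambda>n. f (g n))" by (auto split: nat.split)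
  then show ?case using All by simp
qed auto

lemma ren_inst: "ren f (inst x p) = inst (f x) (ren (lift_ren f) p)"
  unfolding inst_def ren_ren by (rule ren_cong_arity) (auto split: nat.split)

lemma inst_ren_lift: "inst x (ren (lift_ren f) p) = ren (case_nat x f) p"
  unfolding inst_def ren_ren by (rule ren_cong_arity) (auto split: nat.split)

lemma arity_ren: "(\<And>n. n < arity p \<Longrightarrow> f n < b) \<Longrightarrow> arity (ren f p) \<le> b"
proof (induction p arbitrary: f b)
  case (All p)
  have "arity (ren (lift_ren f) p) \<le> Suc b"
    by (rule All.IH) (use All.prems in \<open>auto split: nat.split\<close>)
  then show ?case by simp
qed (auto simp: Suc_le_eq)

section \<open>Structural properties of derivations\<close>

lemma provable_mono: "T \<turnstile> p \<Longrightarrow> T \<subseteq> U \<Longrightarrow> U \<turnstile> p"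
proof (induction arbitrary: U rule: provable.induct)
  case (ImpI p T q)
  then show ?case by (meson insert_mono provable.ImpI)
next
  case (Classical p T)
  then show ?case by (meson insert_mono provable.Classical)
next
  case (AllI T p)
  then show ?case by (meson image_mono provable.AllI)
next
  case (ImpE T p q)
  then show ?case by (meson provable.ImpE)
next
  case (EqE T x y p)
  then show ?case by (meson provable.EqE)
qed (auto intro: provable.Assm provable.AllE provable.EqI)

lemma provable_ren: "T \<turnstile> p \<Longrightarrow> ren f ` T \<turnstile> ren f p"
proof (induction arbitrary: f rule: provable.induct)
  case (AllI T p)
  have "ren (lift_ren f) ` ren Suc ` T = ren Suc ` ren f ` T"
    by (simp add: image_image ren_ren)
  then show ?case using AllI.IH[of "lift_ren f"] by (simp add: provable.AllI)
next
  case (AllE T p x)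
  then show ?case using provable.AllE[of "ren f ` T"] by (simp add: ren_inst)
next
  case (EqE T x y p)
  show ?case unfolding ren_inst
    by (rule provable.EqE) (use EqE.IH[of f] in \<open>simp_all add: ren_inst\<close>)
next
  case (ImpE T p q)
  then show ?case by (metis provable.ImpE ren.simps(4))
qed (auto intro: provable.Assm provable.ImpI provable.Classical provable.EqI)

lemma provable_finite: "T \<turnstile> p \<Longrightarrow> \<exists>U. finite U \<and> U \<subseteq> T \<and> (U \<turnstile> p)"
proof (induction rule: provable.induct)
  case (Assm p T)
  then show ?case by (intro exI[of _ "{p}"]) (auto intro: provable.Assm)
next
  case (ImpI p T q)
  then obtain U where "finite U" "U \<subseteq> insert p T" "U \<turnstile> q" by blast
  moreover from this have "U - {p} \<turnstile> (p \<^bold>\<longrightarrow> q)"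
    by (auto intro!: provable.ImpI elim: provable_mono)
  ultimately show ?case by (intro exI[of _ "U - {p}"]) auto
next
  case (ImpE T p q)
  then obtain U V where "finite U" "U \<subseteq> T" "U \<turnstile> (p \<^bold>\<longrightarrow> q)" "finite V" "V \<subseteq> T" "V \<turnstile> p"
    by blast
  moreover from this have "U \<union> V \<turnstile> q"
    by (meson Un_upper1 Un_upper2 provable.ImpE provable_mono)
  ultimately show ?case by (intro exI[of _ "U \<union> V"]) auto
next
  case (Classical p T)
  then obtain U where "finite U" "U \<subseteq> insert (\<^bold>\<not> p) T" "U \<turnstile> \<^bold>\<bottom>" by blast
  moreover from this have "insert (\<^bold>\<not> p) (U - {\<^bold>\<not> p}) \<turnstile> \<^bold>\<bottom>"
    by (auto elim: provable_mono)
  ultimately show ?case using provable.Classical by (intro exI[of _ "U - {\<^bold>\<not> p}"]) auto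
next
  case (AllI T p)
  then obtain U where "finite U" "U \<subseteq> ren Suc ` T" "U \<turnstile> p" by blast
  moreover from this obtain V where "V \<subseteq> T" "finite V" "U = ren Suc ` V"
    by (meson finite_subset_image)
  ultimately show ?case using provable.AllI by blast
next
  case (EqE T x y p)
  then obtain U V where "finite U" "U \<subseteq> T" "U \<turnstile> (x \<^bold>= y)" "finite V" "V \<subseteq> T" "V \<turnstile> inst x p"
    by blast
  moreover from this have "U \<union> V \<turnstile> inst y p"
    by (meson Un_upper1 Un_upper2 provable.EqE provable_mono)
  ultimately show ?case by (intro exI[of _ "U \<union> V"]) auto
qed (auto intro: provable.AllE provable.EqI)

text \<open>\<open>AllI\<close> knows only variable 0 as eigenvariable. Since \<open>x\<close> does
  not occur in \<open>T\<close>, the renaming that sends \<open>x\<close> to 0 and every other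
  \<open>n\<close> to \<open>Suc n\<close> acts as \<open>Suc\<close> on the assumptions and undoes
  the instantiation of \<open>p\<close>.\<close>

lemma provable_All_fresh:
  assumes "T \<turnstile> inst x p" and T: "\<And>q. q \<in> T \<Longrightarrow> arity q \<le> x" and p: "arity p \<le> Suc x"
  shows "T \<turnstile> All p"
proof -
  let ?f = "\<lambda>n. if n = x then 0 else Suc n"
  have "ren ?f (inst x p) = ren (\<lambda>n. n) p"
    unfolding inst_def ren_ren
    by (rule ren_cong_arity) (use p in \<open>auto split: nat.split\<close>)
  moreover have "ren ?f ` T = ren Suc ` T"
    by (intro image_cong refl ren_cong_arity) (use T in fastforce)
  ultimately show ?thesis
    using provable_ren[OF assms(1), of ?f] by (simp add: AllI)
qed

lemma inconsistent_insert: "insert q T \<turnstile> \<^bold>\<bottom> \<Longrightarrow> insert (\<^bold>\<not> q) T \<turnstile> \<^bold>\<bottom> \<Longrightarrow> T \<turnstile> \<^bold>\<bottom>"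
  by (rule ImpE[OF ImpI Classical])

section \<open>Henkin sets\<close>

definition henkin :: "fm set \<Rightarrow> bool" where
  "henkin U \<longleftrightarrow> \<not> (U \<turnstile> \<^bold>\<bottom>) \<and> (\<forall>q. q \<in> U \<or> (\<^bold>\<not> q) \<in> U) \<and>
     (\<forall>p. (\<^bold>\<not> All p) \<in> U \<longrightarrow> (\<exists>x. (\<^bold>\<not> inst x p) \<in> U))"

instance fm :: countable by countable_datatype

text \<open>The language has no constants; variables above all arities serve as Henkin witnesses.\<close>

lemma henkin_step:
  assumes cons: "\<not> (S \<turnstile> \<^bold>\<bottom>)" and bound: "\<And>r. r \<in> S \<Longrightarrow> arity r \<le> N"
  shows "\<exists>S' N'. S \<subseteq> S' \<and> \<not> (S' \<turnstile> \<^bold>\<bottom>) \<and> (\<forall>r\<in>S'. arity r \<le> N') \<and>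
    (q \<in> S' \<or> (\<^bold>\<not> q) \<in> S') \<and> (\<forall>p. q = All p \<and> q \<notin> S' \<longrightarrow> (\<exists>x. (\<^bold>\<not> inst x p) \<in> S'))"
proof (cases "insert q S \<turnstile> \<^bold>\<bottom>")
  case False
  then show ?thesis
    by (intro exI[of _ "insert q S"] exI[of _ "max N (arity q)"]) (auto dest: bound)
next
  case True
  then have cons': "\<not> (insert (\<^bold>\<not> q) S \<turnstile> \<^bold>\<bottom>)" using cons inconsistent_insert by blast
  show ?thesis
  proof (cases "\<exists>p. q = All p")
    case False
    then show ?thesis using cons'
      by (intro exI[of _ "insert (\<^bold>\<not> q) S"] exI[of _ "max N (arity q)"]) (auto dest: bound)
  next
    case True
    then obtain p where q: "q = All p" by blast
    \<comment> \<open>The variables of \<open>S\<close> lie below \<open>N\<close> and those of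
      \<open>q\<close> below \<open>arity p\<close>, so this \<open>x\<close> is fresh for
      both.\<close>
    define x where "x = max N (arity p)"
    let ?S = "insert (\<^bold>\<not> inst x p) (insert (\<^bold>\<not> q) S)"
    have "\<not> (?S \<turnstile> \<^bold>\<bottom>)"
    proof
      assume "?S \<turnstile> \<^bold>\<bottom>"
      then have "insert (\<^bold>\<not> q) S \<turnstile> inst x p" by (rule Classical)
      then have "insert (\<^bold>\<not> q) S \<turnstile> q"
        unfolding q by (rule provable_All_fresh) (auto simp: x_def dest: bound)
      then show False using cons' Assm ImpE[of _ q "\<^bold>\<bottom>"] by blast
    qed
    moreover have "arity (inst x p) \<le> Suc x"
      unfolding inst_def by (rule arity_ren) (auto simp: x_def split: nat.split)
    ultimately show ?thesis
      by (intro exI[of _ ?S] exI[of _ "Suc x"]) (auto simp: q x_def dest: bound)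
  qed
qed

lemma henkin_extension:
  assumes cons: "\<not> (T \<turnstile> \<^bold>\<bottom>)" and closed: "\<And>q. q \<in> T \<Longrightarrow> arity q = 0"
  shows "\<exists>U. T \<subseteq> U \<and> henkin U"
proof -
  \<comment> \<open>Every stage keeps a finite bound on its arities, which leaves a fresh witness
    for the next formula; the union of the stages need not have such a bound.\<close>
  define P where "P S \<longleftrightarrow> T \<subseteq> S \<and> \<not> (S \<turnstile> \<^bold>\<bottom>) \<and> (\<exists>N. \<forall>r\<in>S. arity r \<le> N)" for S
  define Q where "Q n S S' \<longleftrightarrow> S \<subseteq> S' \<and> (from_nat n \<in> S' \<or> (\<^bold>\<not> from_nat n) \<in> S') \<and>
    (\<forall>p. from_nat n = All p \<and> from_nat n \<notin> S' \<longrightarrow> (\<exists>x. (\<^bold>\<not> inst x p) \<in> S'))"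
    for n :: nat and S S' :: "fm set"
  have "\<exists>S. \<forall>n. P (S n) \<and> Q n (S n) (S (Suc n))"
  proof (rule dependent_nat_choice)
    show "\<exists>S. P S" using cons closed by (auto simp: P_def intro!: exI[of _ T])
    show "\<exists>S'. P S' \<and> Q n S S'" if "P S" for S n
    proof -
      from that obtain N where *: "T \<subseteq> S" "\<not> (S \<turnstile> \<^bold>\<bottom>)" "\<And>r. r \<in> S \<Longrightarrow> arity r \<le> N"
        by (auto simp: P_def)
      from henkin_step[OF *(2,3), of "from_nat n"] show ?thesis
        using *(1) unfolding P_def Q_def by blast
    qed
  qed
  then obtain S where P: "\<And>n. P (S n)" and Q: "\<And>n. Q n (S n) (S (Suc n))" by blast
  define U where "U = (\<Union>n. S n)"
  have mono: "mono S" using Q by (auto simp: mono_iff_le_Suc Q_def)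
  have "\<not> (U \<turnstile> \<^bold>\<bottom>)"
  proof
    assume "U \<turnstile> \<^bold>\<bottom>"
    then obtain V where V: "finite V" "V \<subseteq> U" "V \<turnstile> \<^bold>\<bottom>" using provable_finite by blast
    have "\<exists>n. V \<subseteq> S n" using V(1,2)
    proof (induction rule: finite_induct)
      case (insert r V)
      then obtain m n where "V \<subseteq> S m" "r \<in> S n" by (auto simp: U_def)
      then have "insert r V \<subseteq> S (max m n)"
        using mono by (meson in_mono insert_subsetI max.cobounded1 max.cobounded2 monoD order_trans)
      then show ?case ..
    qed auto
    then show False using V(3) P provable_mono unfolding P_def by blast
  qed
  moreover have "q \<in> U \<or> (\<^bold>\<not> q) \<in> U" for q
    using Q[of "to_nat q"] by (auto simp: Q_def U_def)
  moreover have "\<exists>x. (\<^bold>\<not> inst x p) \<in> U" if "(\<^bold>\<not> All p) \<in> U" for p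
  proof -
    have "All p \<notin> U" using that \<open>\<not> (U \<turnstile> \<^bold>\<bottom>)\<close> Assm ImpE[of U "All p" "\<^bold>\<bottom>"] by blast
    then show ?thesis using Q[of "to_nat (All p)"] by (auto simp: Q_def U_def)
  qed
  moreover have "T \<subseteq> U" using P unfolding P_def U_def by blast
  ultimately show ?thesis unfolding henkin_def by blast
qed

section \<open>Truth in the term model\<close>

lemma henkin_closed: "henkin U \<Longrightarrow> U \<turnstile> p \<Longrightarrow> p \<in> U"
  unfolding henkin_def using Assm ImpE[of U p "\<^bold>\<bottom>"] by blast

lemma henkin_Imp_iff: "henkin U \<Longrightarrow> (p \<^bold>\<longrightarrow> q) \<in> U \<longleftrightarrow> (p \<in> U \<longrightarrow> q \<in> U)"
proof
  assume U: "henkin U" and pq: "p \<in> U \<longrightarrow> q \<in> U"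
  show "(p \<^bold>\<longrightarrow> q) \<in> U"
  proof (cases "p \<in> U")
    case True
    with pq have "insert p U \<turnstile> q" by (simp add: Assm)
    then show ?thesis by (rule henkin_closed[OF U ImpI])
  next
    case False
    then have "(\<^bold>\<not> p) \<in> U" using U unfolding henkin_def by blast
    then have "insert (\<^bold>\<not> q) (insert p U) \<turnstile> \<^bold>\<bottom>"
      by (intro ImpE[of _ p "\<^bold>\<bottom>"] Assm) auto
    then show ?thesis by (rule henkin_closed[OF U ImpI[OF Classical]])
  qed
next
  assume U: "henkin U" and pq: "(p \<^bold>\<longrightarrow> q) \<in> U"
  show "p \<in> U \<longrightarrow> q \<in> U" using henkin_closed[OF U ImpE[OF Assm[OF pq]]] Assm by blast
qed

lemma henkin_All_iff: "henkin U \<Longrightarrow> All p \<in> U \<longleftrightarrow> (\<forall>x. inst x p \<in> U)"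
proof
  assume U: "henkin U" and inst: "\<forall>x. inst x p \<in> U"
  show "All p \<in> U"
  proof (rule ccontr)
    assume "All p \<notin> U"
    then obtain x where "(\<^bold>\<not> inst x p) \<in> U" using U unfolding henkin_def by blast
    then have "U \<turnstile> \<^bold>\<bottom>" using inst Assm ImpE[of U "inst x p" "\<^bold>\<bottom>"] by blast
    then show False using U unfolding henkin_def by blast
  qed
next
  assume U: "henkin U" and p: "All p \<in> U"
  show "\<forall>x. inst x p \<in> U" using henkin_closed[OF U AllE[OF Assm[OF p]]] by blast
qed

lemma henkin_eq_subst: "henkin U \<Longrightarrow> (x \<^bold>= y) \<in> U \<Longrightarrow> inst x p \<in> U \<Longrightarrow> inst y p \<in> U"
  by (rule henkin_closed[OF _ EqE[OF Assm Assm]])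

lemma henkin_eq_iff:
  assumes "henkin U"
  shows "(x \<^bold>= y) \<in> U \<longleftrightarrow> {w. (x \<^bold>= w) \<in> U} = {w. (y \<^bold>= w) \<in> U}"
proof -
  have refl: "(x \<^bold>= x) \<in> U" for x by (rule henkin_closed[OF assms EqI])
  \<comment> \<open>The substituted formula has the instances \<open>x = x\<close> and
    \<open>y = x\<close>.\<close>
  have sym: "(y \<^bold>= x) \<in> U" if "(x \<^bold>= y) \<in> U" for x y
    using henkin_eq_subst[OF assms that, of "0 \<^bold>= Suc x"] refl by (simp add: inst_def)
  have trans: "(x \<^bold>= w) \<in> U" if "(x \<^bold>= y) \<in> U" "(y \<^bold>= w) \<in> U" for x y w
    using henkin_eq_subst[OF assms that(2), of "Suc x \<^bold>= 0"] that(1) by (simp add: inst_def)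
  show ?thesis using refl sym trans by blast
qed

text \<open>The truth lemma. \<open>h\<close> stays abstract because the type of equivalence classes
  is introduced later. The induction runs over all renamings, since instantiating a lifted formula
  yields again a renaming of its body.\<close>

lemma henkin_model:
  fixes h :: "nat \<Rightarrow> 'a"
  assumes U: "henkin U" and surj: "surj h" and h: "\<And>x y. h x = h y \<longleftrightarrow> (x \<^bold>= y) \<in> U"
  shows "sat (\<lambda>a b. \<exists>x y. a = h x \<and> b = h y \<and> (x \<^bold>\<in> y) \<in> U) (\<lambda>n. h (f n)) p \<longleftrightarrow> ren f p \<in> U"
    (is "sat ?E _ _ \<longleftrightarrow> _")
proof (induction p arbitrary: f)
  case (Mem i j)
  have "(x' \<^bold>\<in> y') \<in> U" if "h x = h x'" "h y = h y'" "(x \<^bold>\<in> y) \<in> U" for x y x' y'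
  proof -
    have "(x' \<^bold>\<in> y) \<in> U"
      using henkin_eq_subst[OF U, of x x' "0 \<^bold>\<in> Suc y"] that h by (simp add: inst_def)
    then show ?thesis
      using henkin_eq_subst[OF U, of y y' "Suc x' \<^bold>\<in> 0"] that h by (simp add: inst_def)
  qed
  from this[of _ "f i" _ "f j"] show ?case by (simp only: sat.simps ren.simps) metis
next
  case (Eq i j)
  then show ?case by (simp add: h)
next
  case Fls
  then show ?case using U Assm unfolding henkin_def by auto
next
  case (Imp p q)
  then show ?case by (simp add: henkin_Imp_iff[OF U])
next
  case (All p)
  have *: "case_nat (h x) (\<lambda>n. h (f n)) = (\<lambda>n. h (case_nat x f n))" for x
    by (auto split: nat.split)
  have "(\<forall>a. Q a) \<longleftrightarrow> (\<forall>x. Q (h x))" for Q using surj by (metis surjD)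
  from this[of "\<lambda>a. sat ?E (case_nat a (\<lambda>n. h (f n))) p"] show ?case
    by (simp only: sat.simps ren.simps henkin_All_iff[OF U] * All inst_ren_lift)
qed

section \<open>Definability and models of ZF\<close>

text \<open>
  Terms are functions of the environment, so that elements of the model can occur as parameters and
  definability can be proved by resolution with \<open>definable_intros\<close>.
\<close>

definition simple_term :: "((nat \<Rightarrow> 'a) \<Rightarrow> 'a) \<Rightarrow> bool" where
  "simple_term t \<longleftrightarrow> (\<exists>i. t = (\<lambda>e. e i)) \<or> (\<exists>c. t = (\<lambda>e. c))"

definition definable :: "('a \<Rightarrow> 'a \<Rightarrow> bool) \<Rightarrow> ((nat \<Rightarrow> 'a) \<Rightarrow> bool) \<Rightarrow> bool" where
  "definable E \<Phi> \<longleftrightarrow>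
    (\<exists>p t. (\<forall>n. simple_term (t n)) \<and> (\<forall>e. \<Phi> e \<longleftrightarrow> sat E (\<lambda>n. t n e) p))"

lemma simple_term_var: "simple_term (\<lambda>e. e i)"
  and simple_term_const: "simple_term (\<lambda>e. c)"
  unfolding simple_term_def by blast+

lemma definable_sat: "(\<And>n. simple_term (t n)) \<Longrightarrow> definable E (\<lambda>e. sat E (\<lambda>n. t n e) p)"
  unfolding definable_def by blast

lemma definable_subst:
  assumes "definable E \<Phi>" and s: "\<And>n. simple_term (s n)"
  shows "definable E (\<lambda>e. \<Phi> (\<lambda>n. s n e))"
proof -
  obtain p t where t: "\<And>n. simple_term (t n)" and p: "\<And>e. \<Phi> e \<longleftrightarrow> sat E (\<lambda>n. t n e) p"
    using assms(1) unfolding definable_def by blast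
  have "simple_term (\<lambda>e. t n (\<lambda>i. s i e))" for n
    using t[of n] s unfolding simple_term_def by (elim disjE exE) auto
  from definable_sat[of "\<lambda>n e. t n (\<lambda>i. s i e)", OF this] show ?thesis by (simp add: p)
qed

lemma definable_False: "definable E (\<lambda>e. False)"
  using definable_sat[of "\<lambda>n e. e n" E Fls] by (simp add: simple_term_var)

lemma definable_Imp:
  assumes "definable E \<Phi>" "definable E \<Psi>"
  shows "definable E (\<lambda>e. \<Phi> e \<longrightarrow> \<Psi> e)"
proof -
  obtain p t q s where t: "\<And>n. simple_term (t n)" and p: "\<And>e. \<Phi> e \<longleftrightarrow> sat E (\<lambda>n. t n e) p"
    and s: "\<And>n. simple_term (s n)" and q: "\<And>e. \<Psi> e \<longleftrightarrow> sat E (\<lambda>n. s n e) q"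
    using assms unfolding definable_def by blast
  \<comment> \<open>Even variables carry the terms of \<open>p\<close>, odd ones those of
    \<open>q\<close>.\<close>
  let ?t = "\<lambda>n. if even n then t (n div 2) else s (n div 2)"
  have "definable E (\<lambda>e. sat E (\<lambda>n. ?t n e) (ren (\<lambda>n. 2 * n) p \<^bold>\<longrightarrow> ren (\<lambda>n. 2 * n + 1) q))"
    by (rule definable_sat) (simp add: s t)
  then show ?thesis by (simp add: p q sat_ren)
qed

lemma definable_All:
  assumes "definable E (\<lambda>e. \<Phi> (e 0) (\<lambda>n. e (Suc n)))"
  shows "definable E (\<lambda>e. \<forall>x. \<Phi> x e)"
proof -
  obtain p t where t: "\<And>n. simple_term (t n)"
    and p: "\<And>e. \<Phi> (e 0) (\<lambda>n. e (Suc n)) \<longleftrightarrow> sat E (\<lambda>n. t n e) p"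
    using assms unfolding definable_def by blast
  \<comment> \<open>Several indices may have the bound variable as their term; all are merged into
    variable 0. For these \<open>s n\<close> is an arbitrary simple term.\<close>
  define f where "f n = (if t n = (\<lambda>e. e 0) then 0 else Suc n)" for n
  have "\<exists>s. simple_term s \<and> (\<forall>x e. t n (case_nat x e) = case_nat x (\<lambda>_. s e) (f n))" for n
  proof (cases "t n = (\<lambda>e. e 0)")
    case True
    then show ?thesis using simple_term_var by (auto simp: f_def)
  next
    case False
    from t[of n] consider i where "t n = (\<lambda>e. e i)" | c where "t n = (\<lambda>e. c)"
      unfolding simple_term_def by blast
    then show ?thesis
    proof cases
      case (1 i)
      with False obtain j where "i = Suc j" by (cases i) auto
      with False 1 show ?thesis
        by (intro exI[of _ "\<lambda>e. e j"]) (simp add: f_def simple_term_var)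
    next
      case (2 c)
      with False show ?thesis
        by (intro exI[of _ "\<lambda>e. c"]) (simp add: f_def simple_term_const)
    qed
  qed
  then obtain s where s: "\<And>n. simple_term (s n)"
    and ts: "\<And>n x e. t n (case_nat x e) = case_nat x (\<lambda>_. s n e) (f n)" by metis
  have "f n = 0 \<or> f n = Suc n" for n by (simp add: f_def)
  then have "t n (case_nat x e) = case_nat x (\<lambda>m. s m e) (f n)" for n x e
    unfolding ts by (metis nat.case)
  then have "\<Phi> x e \<longleftrightarrow> sat E (case_nat x (\<lambda>n. s n e)) (ren f p)" for x e
    using p[of "case_nat x e"] by (simp add: sat_ren)
  then show ?thesis using definable_sat[of s E "All (ren f p)"] s by simp
qed

lemma definable_Mem: "simple_term s \<Longrightarrow> simple_term t \<Longrightarrow> definable E (\<lambda>e. E (s e) (t e))"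
  using definable_sat[of "case_nat s (\<lambda>_. t)" E "0 \<^bold>\<in> 1"] by (simp split: nat.split)

lemma definable_Eq: "simple_term s \<Longrightarrow> simple_term t \<Longrightarrow> definable E (\<lambda>e. s e = t e)"
  using definable_sat[of "case_nat s (\<lambda>_. t)" E "0 \<^bold>= 1"] by (simp split: nat.split)

lemma definable_pair:
  "simple_term s \<Longrightarrow> simple_term t \<Longrightarrow> simple_term u \<Longrightarrow>
    definable E (\<lambda>e. is_pair E (s e) (t e) (u e))"
  using definable_sat[of "case_nat s (case_nat t (\<lambda>_. u))" E "pair_fm 0 1 2"]
  by (simp split: nat.split add: eval_nat_numeral)

lemma definable_rel:
  "simple_term r \<Longrightarrow> simple_term s \<Longrightarrow> simple_term t \<Longrightarrow>
    definable E (\<lambda>e. is_rel E (r e) (s e) (t e))"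
  using definable_sat[of "case_nat r (case_nat s (\<lambda>_. t))" E "rel_fm 0 1 2"]
  by (simp split: nat.split add: eval_nat_numeral)

lemma definable_op:
  "simple_term r \<Longrightarrow> simple_term s \<Longrightarrow> simple_term t \<Longrightarrow> simple_term u \<Longrightarrow>
    definable E (\<lambda>e. is_op E (r e) (s e) (t e) (u e))"
  using definable_sat[of "case_nat r (case_nat s (case_nat t (\<lambda>_. u)))" E "op_fm 0 1 2 3"]
  by (simp split: nat.split add: eval_nat_numeral)

lemma definable_Not: "definable E \<Phi> \<Longrightarrow> definable E (\<lambda>e. \<not> \<Phi> e)"
  using definable_Imp[OF _ definable_False] by simp

lemma definable_Or: "definable E \<Phi> \<Longrightarrow> definable E \<Psi> \<Longrightarrow> definable E (\<lambda>e. \<Phi> e \<or> \<Psi> e)"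
  using definable_Imp[OF definable_Not] by (simp add: disj_imp)

lemma definable_And: "definable E \<Phi> \<Longrightarrow> definable E \<Psi> \<Longrightarrow> definable E (\<lambda>e. \<Phi> e \<and> \<Psi> e)"
  using definable_Not[OF definable_Imp[OF _ definable_Not]] by simp

lemma definable_Iff: "definable E \<Phi> \<Longrightarrow> definable E \<Psi> \<Longrightarrow> definable E (\<lambda>e. \<Phi> e \<longleftrightarrow> \<Psi> e)"
  using definable_And[OF definable_Imp definable_Imp] by (simp add: iff_conv_conj_imp)

lemma definable_Ex:
  "definable E (\<lambda>e. \<Phi> (e 0) (\<lambda>n. e (Suc n))) \<Longrightarrow> definable E (\<lambda>e. \<exists>x. \<Phi> x e)"
  using definable_Not[OF definable_All[OF definable_Not]] by simp

lemmas definable_intros =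
  definable_False definable_Mem definable_Eq definable_pair definable_rel definable_op
  definable_Not definable_Or definable_And definable_Imp definable_Iff definable_All definable_Ex
  simple_term_var simple_term_const

section \<open>Closedness of the axioms and of the theorem\<close>

lemma arity_connectives [simp]:
  "arity (p \<^bold>\<or> q) = max (arity p) (arity q)"
  "arity (p \<^bold>\<and> q) = max (arity p) (arity q)"
  "arity (p \<^bold>\<longleftrightarrow> q) = max (arity p) (arity q)"
  "arity (Ex p) = arity p - 1"
  by (auto simp: Or_def And_def Iff_def Ex_def)

lemma arity_univ_closure [simp]: "arity (univ_closure p) = 0"
proof -
  have "arity ((All ^^ n) p) = arity p - n" for n by (induction n) auto
  then show ?thesis by (simp add: univ_closure_def)
qed

lemma arity_ZF: "p \<in> ZF \<Longrightarrow> arity p = 0"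
  by (auto simp: ZF_def separation_def replacement_def extensionality_def foundation_def
      pairing_def union_def power_set_def infinity_def eval_nat_numeral)

lemma arity_sets_of_reals_admit_rigid_relations: "arity sets_of_reals_admit_rigid_relations = 0"
  by (simp add: sets_of_reals_admit_rigid_relations_def reals_fm_def ordered_field_fm_def
      field_fm_def binop_fm_def assoc_fm_def comm_fm_def neutral_fm_def distrib_fm_def
      linorder_fm_def complete_fm_def upper_bound_fm_def subset_fm_def relation_on_fm_def
      rigid_fm_def automorphism_fm_def bij_fm_def op_fm_def rel_fm_def pair_fm_def upair_fm_def)

text \<open>Separation is stated semantically, for predicates definable with parameters, so that
  each use leaves a goal for \<open>definable_intros\<close> instead of a formula to be
  exhibited.\<close>

locale zf_model =
  fixes E :: "'a \<Rightarrow> 'a \<Rightarrow> bool" (infix \<open>\<epsilon>\<close> 50)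
  assumes pairing_ax: "\<exists>z. \<forall>w. w \<epsilon> z \<longleftrightarrow> w = x \<or> w = y"
    and power_ax: "\<exists>u. \<forall>y. y \<epsilon> u \<longleftrightarrow> (\<forall>z. z \<epsilon> y \<longrightarrow> z \<epsilon> x)"
    and separation_ax: "definable E (\<lambda>e. P (e 0)) \<Longrightarrow> \<exists>b. \<forall>x. x \<epsilon> b \<longleftrightarrow> x \<epsilon> a \<and> P x"
begin

abbreviation "pair \<equiv> is_pair E"
abbreviation "rel \<equiv> is_rel E"

lemma pair_ex: "\<exists>z. pair x y z"
proof -
  obtain u v where uv: "\<forall>w. w \<epsilon> u \<longleftrightarrow> w = x" "\<forall>w. w \<epsilon> v \<longleftrightarrow> w = x \<or> w = y"
    using pairing_ax[of x x] pairing_ax[of x y] by auto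
  moreover obtain z where "\<forall>w. w \<epsilon> z \<longleftrightarrow> w = u \<or> w = v" using pairing_ax by blast
  ultimately show ?thesis unfolding is_pair_def by blast
qed

lemma pair_inj: "pair x y z \<Longrightarrow> pair x' y' z \<Longrightarrow> x = x' \<and> y = y'"
proof -
  assume "pair x y z" "pair x' y' z"
  then obtain u v u' v' where u: "\<And>w. w \<epsilon> u \<longleftrightarrow> w = x" and v: "\<And>w. w \<epsilon> v \<longleftrightarrow> w = x \<or> w = y"
    and u': "\<And>w. w \<epsilon> u' \<longleftrightarrow> w = x'" and v': "\<And>w. w \<epsilon> v' \<longleftrightarrow> w = x' \<or> w = y'"
    and z: "\<And>w. w \<epsilon> z \<longleftrightarrow> w = u \<or> w = v" and z': "\<And>w. w \<epsilon> z \<longleftrightarrow> w = u' \<or> w = v'"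
    unfolding is_pair_def by blast
  have "u = u' \<or> u = v'" "v = u' \<or> v = v'" "u' = u \<or> u' = v" "v' = u \<or> v' = v"
    using z z' by blast+
  then show ?thesis using u v u' v' by (smt (verit))
qed

text \<open>Kuratowski pairs over \<open>A\<close> lie in its double power set, which provides the
  bound for separation.\<close>

lemma relation_comprehension:
  assumes P: "definable E (\<lambda>e. P (e 0) (e (Suc 0)))"
  obtains r where "\<And>p. p \<epsilon> r \<Longrightarrow> \<exists>x y. x \<epsilon> A \<and> y \<epsilon> A \<and> pair x y p"
    and "\<And>x y. rel r x y \<longleftrightarrow> x \<epsilon> A \<and> y \<epsilon> A \<and> P x y"
proof -
  obtain B where B: "\<And>y. y \<epsilon> B \<longleftrightarrow> (\<forall>z. z \<epsilon> y \<longrightarrow> z \<epsilon> A)" using power_ax by metis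
  obtain C where C: "\<And>y. y \<epsilon> C \<longleftrightarrow> (\<forall>z. z \<epsilon> y \<longrightarrow> z \<epsilon> B)" using power_ax by metis
  \<comment> \<open>Under the quantifiers over \<open>x\<close> and \<open>y\<close> the inner
    variable \<open>y\<close> gets index 0, so the arguments of \<open>P\<close> appear
    swapped.\<close>
  have "definable E (\<lambda>e. P (e (Suc 0)) (e 0))"
    using definable_subst[OF P, of "\<lambda>n e. e (if n = 0 then Suc 0 else 0)"]
    by (simp add: simple_term_var)
  then have "definable E (\<lambda>e. \<exists>x y. x \<epsilon> A \<and> y \<epsilon> A \<and> pair x y (e 0) \<and> P x y)"
    by (intro definable_intros)
  from separation_ax[OF this, of C] obtain r
    where r: "\<And>p. p \<epsilon> r \<longleftrightarrow> p \<epsilon> C \<and> (\<exists>x y. x \<epsilon> A \<and> y \<epsilon> A \<and> pair x y p \<and> P x y)" by metis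
  have "p \<epsilon> C" if "pair x y p" "x \<epsilon> A" "y \<epsilon> A" for x y p
    using that unfolding is_pair_def C B by metis
  then have "rel r x y \<longleftrightarrow> x \<epsilon> A \<and> y \<epsilon> A \<and> P x y" for x y
    unfolding is_rel_def r using pair_ex pair_inj by metis
  then show ?thesis using r by (intro that[of r]) blast+
qed

end

lemma zf_model:
  assumes "\<And>p. p \<in> ZF \<Longrightarrow> sat E e p"
  shows "zf_model E"
proof
  show "\<exists>z. \<forall>w. E w z \<longleftrightarrow> w = x \<or> w = y" for x y
    using assms[of pairing] by (simp add: ZF_def sat_pairing)
  show "\<exists>u. \<forall>y. E y u \<longleftrightarrow> (\<forall>z. E z y \<longrightarrow> E z x)" for x
    using assms[of power_set] by (simp add: ZF_def sat_power_set)
  show "\<exists>b. \<forall>x. E x b \<longleftrightarrow> E x a \<and> P x" if P: "definable E (\<lambda>e. P (e 0))" for P a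
  proof -
    obtain p t where t: "\<And>n. simple_term (t n)" and p: "\<And>e. P (e 0) \<longleftrightarrow> sat E (\<lambda>n. t n e) p"
      using P unfolding definable_def by blast
    \<comment> \<open>All terms but the element are frozen at an arbitrary environment, since
      \<open>P (e 0)\<close> depends on entry 0 only. The offset 2 skips the index that
      \<open>separation\<close> reserves for the given set.\<close>
    define c where "c n = t n (\<lambda>_. undefined)" for n
    define f where "f n = (if t n = (\<lambda>e. e 0) then 0 else n + 2)" for n
    have "t n (case_nat x (\<lambda>_. undefined)) = case_nat x (case_nat a c) (f n)" for n x
      using t[of n] unfolding simple_term_def
      by (cases "t n = (\<lambda>e. e 0)") (auto simp: f_def c_def split: nat.split)
    then have "P x \<longleftrightarrow> sat E (case_nat x (case_nat a c)) (ren f p)" for x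
      using p[of "case_nat x (\<lambda>_. undefined)"] by (simp add: sat_ren)
    then show ?thesis using assms[of "separation (ren f p)"] by (auto simp: ZF_def sat_separation)
  qed
qed

section \<open>Sign itineraries in complete ordered groups\<close>

text \<open>Completeness is restricted to \<open>sets\<close>: in the application these are the
  extensions of elements of the model, and other subsets of the field may lack suprema.\<close>

locale ordered_group_on =
  fixes K :: "'a set" and add :: "'a \<Rightarrow> 'a \<Rightarrow> 'a" (infixl \<open>\<oplus>\<close> 65) and zero :: 'a (\<open>\<zero>\<close>)
    and less :: "'a \<Rightarrow> 'a \<Rightarrow> bool" (infix \<open>\<prec>\<close> 50) and sets :: "'a set set"
  assumes add_closed [simp]: "x \<in> K \<Longrightarrow> y \<in> K \<Longrightarrow> x \<oplus> y \<in> K"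
    and add_assoc: "x \<in> K \<Longrightarrow> y \<in> K \<Longrightarrow> z \<in> K \<Longrightarrow> x \<oplus> y \<oplus> z = x \<oplus> (y \<oplus> z)"
    and add_comm: "x \<in> K \<Longrightarrow> y \<in> K \<Longrightarrow> x \<oplus> y = y \<oplus> x"
    and zero_closed [simp]: "\<zero> \<in> K"
    and add_0_left [simp]: "x \<in> K \<Longrightarrow> \<zero> \<oplus> x = x"
    and inverse_ex: "x \<in> K \<Longrightarrow> \<exists>y\<in>K. x \<oplus> y = \<zero>"
    and less_irrefl: "x \<in> K \<Longrightarrow> \<not> x \<prec> x"
    and less_trans: "x \<in> K \<Longrightarrow> y \<in> K \<Longrightarrow> z \<in> K \<Longrightarrow> x \<prec> y \<Longrightarrow> y \<prec> z \<Longrightarrow> x \<prec> z"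
    and less_total: "x \<in> K \<Longrightarrow> y \<in> K \<Longrightarrow> x \<prec> y \<or> x = y \<or> y \<prec> x"
    and add_mono: "x \<in> K \<Longrightarrow> y \<in> K \<Longrightarrow> c \<in> K \<Longrightarrow> x \<prec> y \<Longrightarrow> x \<oplus> c \<prec> y \<oplus> c"
    and complete: "S \<in> sets \<Longrightarrow> S \<subseteq> K \<Longrightarrow> S \<noteq> {} \<Longrightarrow> b \<in> K \<Longrightarrow> \<forall>x\<in>S. x \<prec> b \<or> x = b \<Longrightarrow>
      \<exists>s\<in>K. (\<forall>x\<in>S. x \<prec> s \<or> x = s) \<and> (\<forall>c\<in>K. (\<forall>x\<in>S. x \<prec> c \<or> x = c) \<longrightarrow> s \<prec> c \<or> s = c)"
begin

definition le :: "'a \<Rightarrow> 'a \<Rightarrow> bool" (infix \<open>\<preceq>\<close> 50) where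
  "x \<preceq> y \<longleftrightarrow> x \<prec> y \<or> x = y"

lemma add_0_right [simp]: "x \<in> K \<Longrightarrow> x \<oplus> \<zero> = x"
  using add_comm[of x \<zero>] by simp

lemma add_left_comm: "x \<in> K \<Longrightarrow> y \<in> K \<Longrightarrow> z \<in> K \<Longrightarrow> x \<oplus> (y \<oplus> z) = y \<oplus> (x \<oplus> z)"
  using add_assoc add_comm by metis

lemmas add_ac = add_assoc add_comm add_left_comm

definition neg :: "'a \<Rightarrow> 'a" where
  "neg x = (SOME y. y \<in> K \<and> x \<oplus> y = \<zero>)"

lemma neg_closed [simp]: "x \<in> K \<Longrightarrow> neg x \<in> K"
  and add_neg [simp]: "x \<in> K \<Longrightarrow> x \<oplus> neg x = \<zero>"
  using someI_ex[of "\<lambda>y. y \<in> K \<and> x \<oplus> y = \<zero>"] inverse_ex[of x] unfolding neg_def by blast+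

lemma neg_add [simp]: "x \<in> K \<Longrightarrow> neg x \<oplus> x = \<zero>"
  using add_comm[of x "neg x"] by simp

lemma add_right_cancel:
  assumes "x \<in> K" "y \<in> K" "c \<in> K" "x \<oplus> c = y \<oplus> c"
  shows "x = y"
proof -
  have "x \<oplus> c \<oplus> neg c = y \<oplus> c \<oplus> neg c" using assms(4) by simp
  then show ?thesis using assms(1-3) by (simp add: add_assoc)
qed

lemma neg_unique: "x \<in> K \<Longrightarrow> y \<in> K \<Longrightarrow> x \<oplus> y = \<zero> \<Longrightarrow> y = neg x"
  by (rule add_right_cancel[of _ _ x]) (simp_all add: add_comm)

lemma add_le_mono: "x \<in> K \<Longrightarrow> y \<in> K \<Longrightarrow> c \<in> K \<Longrightarrow> x \<preceq> y \<Longrightarrow> x \<oplus> c \<preceq> y \<oplus> c"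
  using add_mono unfolding le_def by blast

lemma add_mono2: "x \<in> K \<Longrightarrow> y \<in> K \<Longrightarrow> x \<prec> y \<Longrightarrow> x \<oplus> x \<prec> y \<oplus> y"
  using add_mono[of x y x] add_mono[of x y y] less_trans[of "x \<oplus> x" "y \<oplus> x" "y \<oplus> y"] add_comm
  by simp

lemma less_asym: "x \<in> K \<Longrightarrow> y \<in> K \<Longrightarrow> x \<prec> y \<Longrightarrow> \<not> y \<prec> x"
  using less_trans less_irrefl by blast

lemma le_trans: "x \<in> K \<Longrightarrow> y \<in> K \<Longrightarrow> z \<in> K \<Longrightarrow> x \<preceq> y \<Longrightarrow> y \<preceq> z \<Longrightarrow> x \<preceq> z"
  using less_trans unfolding le_def by blast

lemma not_less_iff: "x \<in> K \<Longrightarrow> y \<in> K \<Longrightarrow> \<not> x \<prec> y \<longleftrightarrow> y \<preceq> x"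
  using less_total less_asym less_irrefl unfolding le_def by blast

text \<open>The supremum argument behind the Archimedean property: the supremum \<open>s\<close>
  would also bound the shifted set, so \<open>s\<close> minus \<open>c\<close> would be a smaller
  bound. \<open>shift\<close> speaks of upper bounds rather than closure under adding
  \<open>c\<close>, because the differences treated below are only known to be closed under
  doubling.\<close>

lemma no_shift:
  assumes S: "S \<in> sets" "S \<subseteq> K" "S \<noteq> {}" and b: "b \<in> K" "\<forall>x\<in>S. x \<preceq> b"
    and c: "c \<in> K" "\<zero> \<prec> c"
    and shift: "\<And>b d. b \<in> K \<Longrightarrow> \<forall>x\<in>S. x \<preceq> b \<Longrightarrow> d \<in> S \<Longrightarrow> d \<oplus> c \<preceq> b"
  shows False
proof -
  obtain s where s: "s \<in> K" "\<forall>x\<in>S. x \<preceq> s" "\<forall>b\<in>K. (\<forall>x\<in>S. x \<preceq> b) \<longrightarrow> s \<preceq> b"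
    using complete[OF S b(1)] b(2) unfolding le_def by blast
  have "x \<preceq> s \<oplus> neg c" if "x \<in> S" for x
  proof -
    have "x \<in> K" using that S by blast
    moreover from this have "x \<oplus> c \<oplus> neg c \<preceq> s \<oplus> neg c"
      using shift[OF s(1,2) that] s(1) c by (intro add_le_mono) auto
    ultimately show ?thesis using c by (simp add: add_assoc)
  qed
  then have "s \<preceq> s \<oplus> neg c" using s c by simp
  then have "s \<oplus> c \<preceq> s \<oplus> neg c \<oplus> c" using s c by (intro add_le_mono) auto
  then have "c \<oplus> s \<preceq> s" using s(1) c(1) by (simp add: add_assoc add_comm[of s c])
  moreover have "\<zero> \<oplus> s \<prec> c \<oplus> s" using s c by (intro add_mono) auto
  ultimately show False using s(1) c(1) not_less_iff[of s "c \<oplus> s"] by simp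
qed

lemma neg_double_diff:
  assumes "x \<in> K" "d \<in> K"
  shows "neg ((x \<oplus> d) \<oplus> (x \<oplus> d)) \<oplus> (d \<oplus> d) = neg (x \<oplus> x)"
proof (rule neg_unique)
  let ?y = "x \<oplus> d"
  have "x \<oplus> x \<oplus> (n \<oplus> (d \<oplus> d)) = ?y \<oplus> ?y \<oplus> n" if "n \<in> K" for n
    using assms that by (simp add: add_ac)
  from this[of "neg (?y \<oplus> ?y)"] assms
  show "x \<oplus> x \<oplus> (neg (?y \<oplus> ?y) \<oplus> (d \<oplus> d)) = \<zero>" by simp
qed (use assms in auto)

lemma neg_double_less_zero: "x \<in> K \<Longrightarrow> \<zero> \<prec> x \<Longrightarrow> neg (x \<oplus> x) \<prec> \<zero>"
  using add_mono[of \<zero> "x \<oplus> x" "neg (x \<oplus> x)"] add_mono2[of \<zero> x] by simp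

lemma double_eq_zero: "x \<in> K \<Longrightarrow> x \<oplus> x = \<zero> \<Longrightarrow> x = \<zero>"
  using add_mono2[of x \<zero>] add_mono2[of \<zero> x] less_total[of x \<zero>] less_irrefl by auto

text \<open>An expanding map: the nonnegative branch doubles distances, the negative one is a
  translation that carries the images back towards the interval from zero to
  \<open>u\<close>.\<close>

definition step :: "'a \<Rightarrow> 'a \<Rightarrow> 'a" where
  "step u x = (if x \<prec> \<zero> then x \<oplus> u else neg (x \<oplus> x))"

lemma step_closed [simp]: "x \<in> K \<Longrightarrow> u \<in> K \<Longrightarrow> step u x \<in> K"
  by (simp add: step_def)

text \<open>Eliminates \<open>neg\<close>, which is picked by \<open>SOME\<close>, so that the graph
  of the map can be expressed by addition and order alone.\<close>

lemma step_iff: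
  assumes "x \<in> K" "u \<in> K" "y \<in> K"
  shows "y = step u x \<longleftrightarrow> x \<prec> \<zero> \<and> y = x \<oplus> u \<or> \<not> x \<prec> \<zero> \<and> x \<oplus> x \<oplus> y = \<zero>"
  using assms neg_unique[of "x \<oplus> x" y] by (auto simp: step_def)

text \<open>
  A relation that respects signs and is preserved by \<open>step u\<close> relates only equal points: differences of
  related points of the interval from zero to \<open>u\<close> can be doubled indefinitely within that interval, which
  completeness forbids.
\<close>

lemma sign_itinerary_injective:
  assumes u: "u \<in> K" "\<zero> \<prec> u"
    and sym: "\<And>x y. sim x y \<Longrightarrow> sim y x"
    and sign: "\<And>x y. x \<in> K \<Longrightarrow> y \<in> K \<Longrightarrow> sim x y \<Longrightarrow> x \<prec> \<zero> \<longleftrightarrow> y \<prec> \<zero>"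
    and step: "\<And>x y. x \<in> K \<Longrightarrow> y \<in> K \<Longrightarrow> sim x y \<Longrightarrow> sim (step u x) (step u y)"
    and W: "{d \<in> K. \<exists>x\<in>K. \<exists>y\<in>K. \<not> x \<prec> \<zero> \<and> x \<prec> u \<and> \<not> y \<prec> \<zero> \<and> y \<prec> u \<and> sim x y \<and> x \<oplus> d = y} \<in> sets"
      (is "?W \<in> sets")
    and N: "{x \<in> K. x \<prec> \<zero> \<and> (\<exists>y\<in>K. sim x y \<and> x \<noteq> y)} \<in> sets" (is "?N \<in> sets")
    and xy: "x \<in> K" "y \<in> K" "sim x y"
  shows "x = y"
proof -
  \<comment> \<open>Two related points stay together for one passage: \<open>x'\<close>,
    \<open>y'\<close> after doubling, \<open>x2\<close>, \<open>y2\<close> and \<open>x3\<close>,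
    \<open>y3\<close> after one and two additions of \<open>u\<close>. Negation reverses their
    order, so \<open>d \<oplus> d\<close> is the difference of the swapped pair, which
    \<open>sym\<close> admits.\<close>
  have double: "d \<oplus> d \<in> ?W" if d: "d \<in> ?W" "d \<noteq> \<zero>" for d
  proof -
    from d obtain x where dK: "d \<in> K" and x: "x \<in> K" "\<not> x \<prec> \<zero>" "x \<prec> u"
      and y: "\<not> x \<oplus> d \<prec> \<zero>" "x \<oplus> d \<prec> u" "sim x (x \<oplus> d)" by blast
    define y where "y = x \<oplus> d"
    note y = y[folded y_def]
    have yK: "y \<in> K" using x dK by (simp add: y_def)
    define x' y' where "x' = neg (x \<oplus> x)" and "y' = neg (y \<oplus> y)"
    have K': "x' \<in> K" "y' \<in> K" using x yK by (auto simp: x'_def y'_def)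
    have diff: "y' \<oplus> (d \<oplus> d) = x'"
      unfolding x'_def y'_def y_def using x(1) dK by (rule neg_double_diff)
    have "sim x' y'" using step[OF x(1) yK y(3)] x y by (simp add: step_def x'_def y'_def)
    \<comment> \<open>Ensures that two additions of \<open>u\<close> always suffice to become
      positive again.\<close>
    have bound: "\<zero> \<prec> neg (v \<oplus> v) \<oplus> u \<oplus> u" if "v \<in> K" "v \<prec> u" for v
      using add_mono[of "v \<oplus> v" "u \<oplus> u" "neg (v \<oplus> v)"] add_mono2[OF that(1) u(1) that(2)] that u
      by (simp add: add_assoc add_comm[of "neg (v \<oplus> v)"])
    have "x \<noteq> y"
    proof
      assume "x = y"
      then have "\<zero> \<oplus> x = d \<oplus> x" using x dK by (simp add: y_def add_comm)
      then show False using add_right_cancel[of \<zero> d x] x dK d(2) by simp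
    qed
    \<comment> \<open>Zero is fixed by the map. As the two points differ, one is positive; its image
      is negative, and by \<open>sign\<close> so is the other image.\<close>
    then have "\<zero> \<prec> x \<or> \<zero> \<prec> y" using x y yK less_total[of \<zero> x] less_total[of \<zero> y] by auto
    then have "x' \<prec> \<zero> \<or> y' \<prec> \<zero>" using neg_double_less_zero x yK by (auto simp: x'_def y'_def)
    then have neg: "x' \<prec> \<zero>" "y' \<prec> \<zero>" using sign[OF K' \<open>sim x' y'\<close>] by auto
    define x2 y2 where "x2 = x' \<oplus> u" and "y2 = y' \<oplus> u"
    have K2: "x2 \<in> K" "y2 \<in> K" using K' u by (auto simp: x2_def y2_def)
    have "x2 \<prec> u" "y2 \<prec> u"
      using add_mono[OF _ _ u(1) neg(1)] add_mono[OF _ _ u(1) neg(2)] K' u by (auto simp: x2_def y2_def)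
    have "sim x2 y2"
      using step[OF K' \<open>sim x' y'\<close>] neg by (simp add: step_def x2_def y2_def)
    have diff2: "y2 \<oplus> (d \<oplus> d) = x2"
      using diff K' dK u by (simp add: x2_def y2_def add_ac)
    show ?thesis
    proof (cases "x2 \<prec> \<zero>")
      case False
      then have "\<not> y2 \<prec> \<zero>" using sign[OF K2 \<open>sim x2 y2\<close>] by simp
      then show ?thesis
        using False \<open>x2 \<prec> u\<close> \<open>y2 \<prec> u\<close> sym[OF \<open>sim x2 y2\<close>] diff2 K2 dK by auto
    next
      case True
      then have neg2: "y2 \<prec> \<zero>" using sign[OF K2 \<open>sim x2 y2\<close>] by simp
      define x3 y3 where "x3 = x2 \<oplus> u" and "y3 = y2 \<oplus> u"
      have K3: "x3 \<in> K" "y3 \<in> K" using K2 u by (auto simp: x3_def y3_def)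
      have "x3 \<prec> u" "y3 \<prec> u"
        using add_mono[OF _ _ u(1) True] add_mono[OF _ _ u(1) neg2] K2 u by (auto simp: x3_def y3_def)
      moreover have "sim x3 y3"
        using step[OF K2 \<open>sim x2 y2\<close>] True neg2 by (simp add: step_def x3_def y3_def)
      moreover have "y3 \<oplus> (d \<oplus> d) = x3"
        using diff2 K2 dK u by (simp add: x3_def y3_def add_ac)
      moreover have "\<zero> \<prec> x3" "\<zero> \<prec> y3"
        using bound x yK y by (auto simp: x3_def y3_def x2_def y2_def x'_def y'_def)
      then have "\<not> x3 \<prec> \<zero>" "\<not> y3 \<prec> \<zero>" using less_asym K3 by auto
      ultimately show ?thesis using K3 dK sym by auto
    qed
  qed
  \<comment> \<open>A positive \<open>w\<close> would let every upper bound absorb a shift by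
    \<open>w\<close>: \<open>d \<oplus> w\<close> is at most \<open>d \<oplus> d\<close> or
    \<open>w \<oplus> w\<close>, whichever of \<open>d\<close> and \<open>w\<close> is larger, and
    both doubles are again differences.\<close>
  have W_nonpos: "\<not> \<zero> \<prec> w" if w: "w \<in> ?W" for w
  proof
    assume "\<zero> \<prec> w"
    have wK: "w \<in> K" using w by simp
    have pos: "v \<noteq> \<zero>" if "v \<in> K" "w \<preceq> v" for v
      using that \<open>\<zero> \<prec> w\<close> less_asym[of v w] wK less_irrefl by (auto simp: le_def)
    show False
    proof (rule no_shift[OF W _ _ u(1) _ wK \<open>\<zero> \<prec> w\<close>])
      show "\<forall>d\<in>?W. d \<preceq> u"
      proof
        fix d assume "d \<in> ?W"
        then obtain x where x: "d \<in> K" "x \<in> K" "\<not> x \<prec> \<zero>" "x \<oplus> d \<prec> u" by blast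
        then have "\<zero> \<oplus> d \<preceq> x \<oplus> d" using not_less_iff by (intro add_le_mono) auto
        then show "d \<preceq> u" using x u le_trans[of d "x \<oplus> d" u] by (simp add: le_def)
      qed
      fix b d assume b: "b \<in> K" "\<forall>x\<in>?W. x \<preceq> b" and d: "d \<in> ?W"
      then have dK: "d \<in> K" by simp
      show "d \<oplus> w \<preceq> b"
      proof (cases "w \<preceq> d")
        case True
        then have "w \<oplus> d \<preceq> d \<oplus> d" using wK dK by (intro add_le_mono)
        moreover have "d \<oplus> d \<preceq> b" using b(2) double[OF d pos[OF dK True]] by blast
        ultimately show ?thesis using le_trans[of "w \<oplus> d" "d \<oplus> d" b] wK dK b(1) add_comm by simp
      next
        case False
        then have "d \<preceq> w" using less_total[OF wK dK] by (auto simp: le_def)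
        then have "d \<oplus> w \<preceq> w \<oplus> w" using wK dK by (intro add_le_mono)
        moreover have "w \<noteq> \<zero>" using pos[OF wK] by (simp add: le_def)
        then have "w \<oplus> w \<preceq> b" using b(2) double[OF w] by blast
        ultimately show ?thesis using le_trans[of "d \<oplus> w" "w \<oplus> w" b] wK dK b(1) by simp
      qed
    qed (use w in auto)
  qed
  have unit: "x = y"
    if "x \<in> K" "y \<in> K" "sim x y" "\<not> x \<prec> \<zero>" "x \<prec> u" "\<not> y \<prec> \<zero>" "y \<prec> u" for x y
  proof -
    have "\<not> x \<prec> y"
      if xy: "x \<in> K" "y \<in> K" "sim x y" "\<not> x \<prec> \<zero>" "x \<prec> u" "\<not> y \<prec> \<zero>" "y \<prec> u" for x y
    proof
      assume "x \<prec> y"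
      then have "x \<oplus> neg x \<prec> y \<oplus> neg x" using xy by (intro add_mono) auto
      moreover have "x \<oplus> (y \<oplus> neg x) = y" using xy by (simp add: add_left_comm[of x y])
      then have "y \<oplus> neg x \<in> ?W" using xy by auto
      ultimately show False using W_nonpos xy by simp
    qed
    then show ?thesis using that sym less_total by blast
  qed
  \<comment> \<open>Adding \<open>u\<close> to a related but unequal negative pair cannot bring it
    into the interval, where \<open>unit\<close> forces equality. So \<open>?N\<close> is closed
    under adding \<open>u\<close> while zero bounds it.\<close>
  have negative: "x = y" if "x \<in> K" "y \<in> K" "sim x y" "x \<prec> \<zero>" for x y
  proof (rule ccontr)
    assume "x \<noteq> y"
    show False
    proof (rule no_shift[OF N _ _ zero_closed _ u])
      show "?N \<noteq> {}" using that \<open>x \<noteq> y\<close> by blast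
      fix b d assume b: "b \<in> K" "\<forall>x\<in>?N. x \<preceq> b" and "d \<in> ?N"
      then obtain y where d: "d \<in> K" "d \<prec> \<zero>" "y \<in> K" "sim d y" "d \<noteq> y" by blast
      have y: "y \<prec> \<zero>" using sign d by blast
      have sim: "sim (d \<oplus> u) (y \<oplus> u)" using step[of d y] d y by (simp add: step_def)
      have ne: "d \<oplus> u \<noteq> y \<oplus> u" using add_right_cancel d u by blast
      have lt: "d \<oplus> u \<prec> u" "y \<oplus> u \<prec> u"
        using add_mono[of d \<zero> u] add_mono[of y \<zero> u] d y u by auto
      have "d \<oplus> u \<prec> \<zero>"
      proof (rule ccontr)
        assume *: "\<not> d \<oplus> u \<prec> \<zero>"
        then have "\<not> y \<oplus> u \<prec> \<zero>" using sign[OF _ _ sim] d u by simp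
        then show False using unit[OF _ _ sim * lt(1)] lt ne d u by simp
      qed
      then have "d \<oplus> u \<in> ?N" using sim ne d u by auto
      then show "d \<oplus> u \<preceq> b" using b by blast
    qed (auto simp: le_def)
  qed
  show ?thesis
  proof (cases "x \<prec> \<zero>")
    case True
    then show ?thesis using negative xy by blast
  next
    case False
    then have y: "\<not> y \<prec> \<zero>" using sign xy by blast
    show ?thesis
    proof (rule ccontr)
      assume "x \<noteq> y"
      \<comment> \<open>One step makes at least one of the points negative, so the images agree by
        \<open>negative\<close>, and an ordered group has no element of order two.\<close>
      then have "\<zero> \<prec> x \<or> \<zero> \<prec> y"
        using False y xy less_total[of \<zero> x] less_total[of \<zero> y] by auto
      then have "neg (x \<oplus> x) \<prec> \<zero> \<or> neg (y \<oplus> y) \<prec> \<zero>" using neg_double_less_zero xy by auto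
      moreover have sim: "sim (neg (x \<oplus> x)) (neg (y \<oplus> y))"
        using step[OF xy] False y by (simp add: step_def)
      ultimately have "neg (x \<oplus> x) = neg (y \<oplus> y)"
        using negative[OF _ _ sim] sign[OF _ _ sim] xy by auto
      moreover define d where "d = y \<oplus> neg x"
      have d: "d \<in> K" "y = x \<oplus> d" using xy by (simp_all add: d_def add_left_comm[of x y])
      ultimately have "neg (x \<oplus> x) \<oplus> (d \<oplus> d) = neg (x \<oplus> x)"
        using neg_double_diff[OF xy(1) d(1)] by simp
      then have "d \<oplus> d \<oplus> neg (x \<oplus> x) = \<zero> \<oplus> neg (x \<oplus> x)" using d xy by (simp add: add_comm)
      then have "d \<oplus> d = \<zero>" using add_right_cancel[of "d \<oplus> d" \<zero> "neg (x \<oplus> x)"] d(1) xy(1) by simp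
      then have "d = \<zero>" using double_eq_zero d by blast
      then show False using d xy \<open>x \<noteq> y\<close> by simp
    qed
  qed
qed

end

section \<open>Rigid relations inside a model\<close>

context zf_model
begin

definition relation_on :: "'a \<Rightarrow> 'a \<Rightarrow> bool" where
  "relation_on r A \<longleftrightarrow> (\<forall>q. q \<epsilon> r \<longrightarrow> (\<exists>x. x \<epsilon> A \<and> (\<exists>y. y \<epsilon> A \<and> pair x y q)))"

definition automorphism :: "'a \<Rightarrow> 'a \<Rightarrow> 'a \<Rightarrow> bool" where
  "automorphism f A r \<longleftrightarrow>
    (relation_on f A \<and>
     (\<forall>x. x \<epsilon> A \<longrightarrow> (\<exists>y. \<forall>w. rel f x w \<longleftrightarrow> w = y)) \<and>
     (\<forall>x y z. x \<epsilon> A \<and> y \<epsilon> A \<and> rel f x z \<and> rel f y z \<longrightarrow> x = y) \<and>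
     (\<forall>y. y \<epsilon> A \<longrightarrow> (\<exists>x. x \<epsilon> A \<and> rel f x y))) \<and>
    (\<forall>x y u v. x \<epsilon> A \<and> y \<epsilon> A \<and> rel f x u \<and> rel f y v \<longrightarrow> (rel r x y \<longleftrightarrow> rel r u v))"

definition rigid :: "'a \<Rightarrow> 'a \<Rightarrow> bool" where
  "rigid A r \<longleftrightarrow> (\<forall>f. automorphism f A r \<longrightarrow> (\<forall>x. x \<epsilon> A \<longrightarrow> rel f x x))"

text \<open>Replaces the graph \<open>f\<close> by a function outside the model. That its values lie
  in \<open>A\<close> comes from \<open>f\<close> being a relation on \<open>A\<close>.\<close>

lemma automorphismE:
  assumes "automorphism f A r"
  obtains \<phi> where "\<And>x w. x \<epsilon> A \<Longrightarrow> rel f x w \<longleftrightarrow> w = \<phi> x"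
    and "\<And>x. x \<epsilon> A \<Longrightarrow> \<phi> x \<epsilon> A"
    and "\<And>x y. x \<epsilon> A \<Longrightarrow> y \<epsilon> A \<Longrightarrow> \<phi> x = \<phi> y \<Longrightarrow> x = y"
    and "\<And>y. y \<epsilon> A \<Longrightarrow> \<exists>x. x \<epsilon> A \<and> y = \<phi> x"
    and "\<And>x y. x \<epsilon> A \<Longrightarrow> y \<epsilon> A \<Longrightarrow> rel r x y \<longleftrightarrow> rel r (\<phi> x) (\<phi> y)"
proof -
  note aut = assms[unfolded automorphism_def]
  have f: "relation_on f A" using aut by (elim conjE)
  have total: "\<forall>x. x \<epsilon> A \<longrightarrow> (\<exists>y. \<forall>w. rel f x w \<longleftrightarrow> w = y)" using aut by (elim conjE)
  have inj: "\<forall>x y z. x \<epsilon> A \<and> y \<epsilon> A \<and> rel f x z \<and> rel f y z \<longrightarrow> x = y" using aut by (elim conjE)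
  have surj: "\<forall>y. y \<epsilon> A \<longrightarrow> (\<exists>x. x \<epsilon> A \<and> rel f x y)" using aut by (elim conjE)
  have pres: "\<forall>x y u v. x \<epsilon> A \<and> y \<epsilon> A \<and> rel f x u \<and> rel f y v \<longrightarrow> (rel r x y \<longleftrightarrow> rel r u v)"
    using aut by (elim conjE)
  define \<phi> where "\<phi> x = (THE y. rel f x y)" for x
  have \<phi>: "rel f x w \<longleftrightarrow> w = \<phi> x" if x: "x \<epsilon> A" for x w
  proof -
    obtain y where "\<forall>w. rel f x w \<longleftrightarrow> w = y" using total x by blast
    then show ?thesis by (simp add: \<phi>_def)
  qed
  have closed: "\<phi> x \<epsilon> A" if "x \<epsilon> A" for x
  proof -
    have "rel f x (\<phi> x)" using \<phi> that by blast
    then obtain q where q: "q \<epsilon> f" "pair x (\<phi> x) q" unfolding is_rel_def by blast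
    then obtain x' y' where "y' \<epsilon> A" "pair x' y' q"
      using f unfolding relation_on_def by blast
    then show ?thesis using pair_inj q by blast
  qed
  show ?thesis
  proof (rule that[OF \<phi> closed])
    show "x = y" if "x \<epsilon> A" "y \<epsilon> A" "\<phi> x = \<phi> y" for x y
      using inj that \<phi> by metis
    show "\<exists>x. x \<epsilon> A \<and> y = \<phi> x" if "y \<epsilon> A" for y
      using surj that \<phi> by metis
    show "rel r x y \<longleftrightarrow> rel r (\<phi> x) (\<phi> y)" if "x \<epsilon> A" "y \<epsilon> A" for x y
      using pres that \<phi> by metis
  qed
qed

end

text \<open>
  \<open>Z\<close> is the least set that contains \<open>a\<close> and is closed under the injection \<open>\<phi>\<close>, whose graph is \<open>f\<close>. It
  serves as a copy of the natural numbers with zero \<open>a\<close> and successor \<open>\<phi>\<close>.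
\<close>

locale orbit = zf_model E for E :: "'a \<Rightarrow> 'a \<Rightarrow> bool" (infix \<open>\<epsilon>\<close> 50) +
  fixes A f a Z :: 'a and \<phi> :: "'a \<Rightarrow> 'a"
  assumes f_iff: "x \<epsilon> A \<Longrightarrow> rel f x w \<longleftrightarrow> w = \<phi> x"
    and \<phi>_closed: "x \<epsilon> A \<Longrightarrow> \<phi> x \<epsilon> A"
    and \<phi>_inj: "x \<epsilon> A \<Longrightarrow> y \<epsilon> A \<Longrightarrow> \<phi> x = \<phi> y \<Longrightarrow> x = y"
    and a_in_A: "a \<epsilon> A"
    and Z_iff: "x \<epsilon> Z \<longleftrightarrow> x \<epsilon> A \<and>
      (\<forall>X. a \<epsilon> X \<and> (\<forall>y w. y \<epsilon> A \<and> y \<epsilon> X \<and> rel f y w \<longrightarrow> w \<epsilon> X) \<longrightarrow> x \<epsilon> X)"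
begin

lemma Z_subset: "x \<epsilon> Z \<Longrightarrow> x \<epsilon> A"
  using Z_iff by blast

lemma a_in_Z: "a \<epsilon> Z"
  unfolding Z_iff using a_in_A by blast

lemma Z_closed: "x \<epsilon> Z \<Longrightarrow> \<phi> x \<epsilon> Z"
  unfolding Z_iff using \<phi>_closed f_iff by blast

text \<open>Minimality of \<open>Z\<close> is about elements \<open>X\<close> of the model, so the
  predicate must first be turned into one by separation.\<close>

lemma Z_induct:
  assumes "x \<epsilon> Z" "definable E (\<lambda>e. P (e 0))" "P a" "\<And>x. x \<epsilon> Z \<Longrightarrow> P x \<Longrightarrow> P (\<phi> x)"
  shows "P x"
proof -
  obtain X where X: "\<And>x. x \<epsilon> X \<longleftrightarrow> x \<epsilon> Z \<and> P x" using separation_ax[OF assms(2), of Z] by blast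
  have "w \<epsilon> X" if "y \<epsilon> A" "y \<epsilon> X" "rel f y w" for y w
  proof -
    have "w = \<phi> y" using f_iff that by blast
    then show ?thesis using that(2) assms(4)[of y] Z_closed[of y] X by simp
  qed
  moreover have "a \<epsilon> X" using X a_in_Z assms(3) by blast
  ultimately have "x \<epsilon> X" using assms(1) unfolding Z_iff by blast
  then show ?thesis using X by blast
qed

lemma Z_cases: "x \<epsilon> Z \<Longrightarrow> x = a \<or> (\<exists>y. y \<epsilon> Z \<and> x = \<phi> y)"
proof -
  assume "x \<epsilon> Z"
  \<comment> \<open>\<phi> lives outside the model, so the predicate used for induction speaks of
    its graph \<open>f\<close>.\<close>
  then have "x = a \<or> (\<exists>y. y \<epsilon> Z \<and> rel f y x)"
  proof (rule Z_induct)
    show "definable E (\<lambda>e. e 0 = a \<or> (\<exists>y. y \<epsilon> Z \<and> rel f y (e 0)))"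
      by (intro definable_intros)
  qed (use f_iff Z_subset in blast)+
  then show ?thesis using f_iff Z_subset by blast
qed

end

section \<open>The additive group of the reals inside the model\<close>

locale complete_group = zf_model E for E :: "'a \<Rightarrow> 'a \<Rightarrow> bool" (infix \<open>\<epsilon>\<close> 50) +
  fixes F p zero l :: 'a
  assumes zero_in_F: "zero \<epsilon> F"
    and op_ex: "x \<epsilon> F \<Longrightarrow> y \<epsilon> F \<Longrightarrow> \<exists>w. w \<epsilon> F \<and> (\<forall>v. is_op E p x y v \<longleftrightarrow> v = w)"
    and op_assoc: "x \<epsilon> F \<Longrightarrow> y \<epsilon> F \<Longrightarrow> z \<epsilon> F \<Longrightarrow>
       \<exists>xy yz w. xy \<epsilon> F \<and> yz \<epsilon> F \<and> w \<epsilon> F \<and>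
          is_op E p x y xy \<and> is_op E p y z yz \<and> is_op E p xy z w \<and> is_op E p x yz w"
    and op_comm: "x \<epsilon> F \<Longrightarrow> y \<epsilon> F \<Longrightarrow> z \<epsilon> F \<Longrightarrow> is_op E p x y z \<Longrightarrow> is_op E p y x z"
    and op_zero: "x \<epsilon> F \<Longrightarrow> is_op E p zero x x"
    and op_inverse: "x \<epsilon> F \<Longrightarrow> \<exists>y. y \<epsilon> F \<and> is_op E p x y zero"
    and l_irrefl: "x \<epsilon> F \<Longrightarrow> \<not> rel l x x"
    and l_trans: "x \<epsilon> F \<Longrightarrow> y \<epsilon> F \<Longrightarrow> z \<epsilon> F \<Longrightarrow> rel l x y \<Longrightarrow> rel l y z \<Longrightarrow> rel l x z"
    and l_total: "x \<epsilon> F \<Longrightarrow> y \<epsilon> F \<Longrightarrow> rel l x y \<or> x = y \<or> rel l y x"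
    and l_op: "x \<epsilon> F \<Longrightarrow> y \<epsilon> F \<Longrightarrow> c \<epsilon> F \<Longrightarrow> s \<epsilon> F \<Longrightarrow> t \<epsilon> F \<Longrightarrow>
       rel l x y \<Longrightarrow> is_op E p x c s \<Longrightarrow> is_op E p y c t \<Longrightarrow> rel l s t"
    and l_complete: "\<forall>x. x \<epsilon> s \<longrightarrow> x \<epsilon> F \<Longrightarrow> \<exists>x. x \<epsilon> s \<Longrightarrow>
       \<exists>b. b \<epsilon> F \<and> (\<forall>x. x \<epsilon> s \<longrightarrow> rel l x b \<or> x = b) \<Longrightarrow>
       \<exists>b. b \<epsilon> F \<and> (\<forall>x. x \<epsilon> s \<longrightarrow> rel l x b \<or> x = b) \<and>
          (\<forall>c. c \<epsilon> F \<and> (\<forall>x. x \<epsilon> s \<longrightarrow> rel l x c \<or> x = c) \<longrightarrow> rel l b c \<or> b = c)"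
    and nontrivial: "\<exists>x. x \<epsilon> F \<and> x \<noteq> zero"
begin

definition plus :: "'a \<Rightarrow> 'a \<Rightarrow> 'a" where
  "plus x y = (THE w. is_op E p x y w)"

lemma op_iff: "x \<epsilon> F \<Longrightarrow> y \<epsilon> F \<Longrightarrow> is_op E p x y v \<longleftrightarrow> v = plus x y"
  and plus_closed: "x \<epsilon> F \<Longrightarrow> y \<epsilon> F \<Longrightarrow> plus x y \<epsilon> F"
proof -
  assume "x \<epsilon> F" "y \<epsilon> F"
  from op_ex[OF this] obtain w where "w \<epsilon> F" "\<forall>v. is_op E p x y v \<longleftrightarrow> v = w" by blast
  then show "is_op E p x y v \<longleftrightarrow> v = plus x y" "plus x y \<epsilon> F" by (simp_all add: plus_def)
qed

sublocale group: ordered_group_on "{x. x \<epsilon> F}" plus zero "rel l" "range (\<lambda>s. {x. x \<epsilon> s})"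
proof
  show "plus (plus x y) z = plus x (plus y z)"
    if "x \<in> {x. x \<epsilon> F}" "y \<in> {x. x \<epsilon> F}" "z \<in> {x. x \<epsilon> F}" for x y z
    using op_assoc[of x y z] that op_iff by auto
  show "plus x y = plus y x" if "x \<in> {x. x \<epsilon> F}" "y \<in> {x. x \<epsilon> F}" for x y
    using op_comm[of x y "plus x y"] that op_iff plus_closed by auto
  show "plus zero x = x" if "x \<in> {x. x \<epsilon> F}" for x
    using op_zero[of x] that op_iff zero_in_F by auto
  show "\<exists>y\<in>{x. x \<epsilon> F}. plus x y = zero" if "x \<in> {x. x \<epsilon> F}" for x
    using op_inverse[of x] that op_iff by auto
  show "rel l (plus x c) (plus y c)"
    if "x \<in> {x. x \<epsilon> F}" "y \<in> {x. x \<epsilon> F}" "c \<in> {x. x \<epsilon> F}" "rel l x y" for x y c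
    using l_op[of x y c "plus x c" "plus y c"] that op_iff plus_closed by auto
  show "\<exists>s\<in>{x. x \<epsilon> F}. (\<forall>x\<in>S. rel l x s \<or> x = s) \<and>
      (\<forall>c\<in>{x. x \<epsilon> F}. (\<forall>x\<in>S. rel l x c \<or> x = c) \<longrightarrow> rel l s c \<or> s = c)"
    if "S \<in> range (\<lambda>s. {x. x \<epsilon> s})" "S \<subseteq> {x. x \<epsilon> F}" "S \<noteq> {}" "b \<in> {x. x \<epsilon> F}"
      "\<forall>x\<in>S. rel l x b \<or> x = b" for S b
  proof -
    from that(1) obtain s where S: "S = {x. x \<epsilon> s}" by blast
    have "\<forall>x. x \<epsilon> s \<longrightarrow> x \<epsilon> F" "\<exists>x. x \<epsilon> s" using that(2,3) S by blast+
    moreover have "\<exists>b. b \<epsilon> F \<and> (\<forall>x. x \<epsilon> s \<longrightarrow> rel l x b \<or> x = b)" using that(4,5) S by blast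
    ultimately obtain b where "b \<epsilon> F" "\<forall>x. x \<epsilon> s \<longrightarrow> rel l x b \<or> x = b"
      "\<forall>c. c \<epsilon> F \<and> (\<forall>x. x \<epsilon> s \<longrightarrow> rel l x c \<or> x = c) \<longrightarrow> rel l b c \<or> b = c"
      using l_complete by blast
    then show ?thesis unfolding S by (intro bexI[of _ b]) auto
  qed
qed (simp_all add: plus_closed zero_in_F l_irrefl l_total, rule l_trans)

lemma positive_ex: "\<exists>u. u \<epsilon> F \<and> rel l zero u"
proof -
  obtain x where x: "x \<epsilon> F" "x \<noteq> zero" using nontrivial by blast
  show ?thesis
  proof (cases "rel l zero x")
    case False
    then have "rel l x zero" using l_total[of x zero] x zero_in_F by blast
    then have "rel l zero (group.neg x)"
      using group.add_mono[of x zero "group.neg x"] x group.neg_closed[of x] zero_in_F by simp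
    then show ?thesis using group.neg_closed[of x] x by auto
  qed (use x in blast)
qed

end

text \<open>With \<open>a_not_image\<close>, \<open>Z\<close> satisfies the Peano axioms, which
  makes the clauses for codes invertible.\<close>

locale coding = complete_group E F p zero l + orbit E A f a Z \<phi>
  for E :: "'a \<Rightarrow> 'a \<Rightarrow> bool" (infix \<open>\<epsilon>\<close> 50) and F p zero l A f a Z \<phi> +
  fixes u :: 'a
  assumes A_subset: "x \<epsilon> A \<Longrightarrow> x \<epsilon> F"
    and u: "u \<epsilon> F" "rel l zero u"
    and a_not_image: "x \<epsilon> Z \<Longrightarrow> \<phi> x \<noteq> a"
begin

definition step_graph :: "'a \<Rightarrow> 'a \<Rightarrow> bool" where
  "step_graph x y \<longleftrightarrow> rel l x zero \<and> is_op E p x u y \<or>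
    \<not> rel l x zero \<and> (\<exists>s. is_op E p x x s \<and> is_op E p s y zero)"

text \<open>The two clauses of an inductive definition along \<open>Z\<close>. Passing to the least
  closed relation avoids a recursion theorem in the model, and graphs in place of functions keep it
  definable.\<close>

definition code_closed :: "'a \<Rightarrow> bool" where
  "code_closed X \<longleftrightarrow> (\<forall>x. x \<epsilon> F \<and> rel l x zero \<longrightarrow> rel X x a) \<and>
    (\<forall>x y v w. x \<epsilon> F \<and> y \<epsilon> F \<and> v \<epsilon> Z \<and> step_graph x y \<and> rel f v w \<and> rel X y v \<longrightarrow> rel X x w)"

text \<open>If \<open>v\<close> is the \<open>n\<close>-th element of \<open>Z\<close>, then \<open>code x v\<close> says that the \<open>n\<close>-th iterate of \<open>x\<close> under
  the step map is negative.\<close>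

definition code :: "'a \<Rightarrow> 'a \<Rightarrow> bool" where
  "code x v \<longleftrightarrow> (\<forall>X. code_closed X \<longrightarrow> rel X x v)"

definition same_code :: "'a \<Rightarrow> 'a \<Rightarrow> bool" where
  "same_code x y \<longleftrightarrow> (\<forall>v. v \<epsilon> Z \<longrightarrow> (code x v \<longleftrightarrow> code y v))"

lemmas code_defs = same_code_def code_def code_closed_def step_graph_def

abbreviation "step \<equiv> group.step u"

lemma step_in_F: "x \<epsilon> F \<Longrightarrow> step x \<epsilon> F"
  using group.step_closed[of x u] u by simp

lemma step_graph_iff: "x \<epsilon> F \<Longrightarrow> y \<epsilon> F \<Longrightarrow> step_graph x y \<longleftrightarrow> y = step x"
  using group.step_iff[of x u y] u op_iff plus_closed unfolding step_graph_def by auto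

lemma code_closed_iff:
  "code_closed X \<longleftrightarrow> (\<forall>x. x \<epsilon> F \<and> rel l x zero \<longrightarrow> rel X x a) \<and>
    (\<forall>x v. x \<epsilon> F \<and> v \<epsilon> Z \<and> rel X (step x) v \<longrightarrow> rel X x (\<phi> v))"
proof -
  have "x \<epsilon> F \<and> y \<epsilon> F \<and> v \<epsilon> Z \<and> step_graph x y \<and> rel f v w \<and> rel X y v \<longleftrightarrow>
      x \<epsilon> F \<and> v \<epsilon> Z \<and> rel X y v \<and> y = step x \<and> w = \<phi> v" for x y v w
    using step_graph_iff[of x y] step_in_F[of x] f_iff[of v w] Z_subset[of v] by metis
  then show ?thesis unfolding code_closed_def by (simp only:) blast
qed

lemma Z_in_F: "x \<epsilon> Z \<Longrightarrow> x \<epsilon> F"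
  using A_subset Z_subset by blast

lemma code_a: "x \<epsilon> F \<Longrightarrow> rel l x zero \<Longrightarrow> code x a"
  and code_\<phi>: "x \<epsilon> F \<Longrightarrow> v \<epsilon> Z \<Longrightarrow> code (step x) v \<Longrightarrow> code x (\<phi> v)"
  unfolding code_def code_closed_iff by blast+

text \<open>Inversion by minimality: dropping from the least relation all pairs of a nonnegative
  point with \<open>a\<close> leaves it closed, because the successor clause never produces
  \<open>a\<close>.\<close>

lemma code_a_iff: "x \<epsilon> F \<Longrightarrow> code x a \<longleftrightarrow> rel l x zero"
proof
  assume x: "x \<epsilon> F" "code x a"
  have "definable E (\<lambda>e. code (e 0) (e (Suc 0)) \<and> (e (Suc 0) = a \<longrightarrow> rel l (e 0) zero))"
    unfolding code_defs by (intro definable_intros)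
  from relation_comprehension[OF this, of F] obtain X where
    X: "\<And>x v. rel X x v \<longleftrightarrow> x \<epsilon> F \<and> v \<epsilon> F \<and> code x v \<and> (v = a \<longrightarrow> rel l x zero)" by metis
  have "code_closed X"
    unfolding code_closed_iff X
    by (auto intro: code_a code_\<phi> Z_in_F Z_closed a_in_Z dest: a_not_image)
  then have "rel X x a" using x(2) unfolding code_def by blast
  then show "rel l x zero" using X by blast
qed (rule code_a)

lemma code_\<phi>_iff: "x \<epsilon> F \<Longrightarrow> v \<epsilon> Z \<Longrightarrow> code x (\<phi> v) \<longleftrightarrow> code (step x) v"
proof
  assume x: "x \<epsilon> F" "v \<epsilon> Z" "code x (\<phi> v)"
  show "code (step x) v"
  proof (rule ccontr)
    assume not: "\<not> code (step x) v"
    define w where "w = \<phi> v"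
    have "definable E (\<lambda>e. code (e 0) (e (Suc 0)) \<and> \<not> (e 0 = x \<and> e (Suc 0) = w))"
      unfolding code_defs by (intro definable_intros)
    from relation_comprehension[OF this, of F] obtain X where
      X: "\<And>x' v. rel X x' v \<longleftrightarrow> x' \<epsilon> F \<and> v \<epsilon> F \<and> code x' v \<and> \<not> (x' = x \<and> v = w)" by metis
    have "v' = v" if "v' \<epsilon> Z" "\<phi> v' = w" for v'
      using that x(2) \<phi>_inj Z_subset unfolding w_def by blast
    moreover have "w \<noteq> a" using a_not_image x(2) unfolding w_def by blast
    ultimately have "code_closed X"
      unfolding code_closed_iff X
      using not by (auto intro: code_a code_\<phi> Z_in_F Z_closed a_in_Z)
    then have "rel X x w" using x(3) unfolding code_def w_def by blast
    then show False using X by blast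
  qed
qed (rule code_\<phi>)

text \<open>The two sets to which the itinerary argument applies completeness belong to the model
  because \<open>same_code\<close> unfolds to a definable predicate.\<close>

lemma same_code_imp_eq:
  assumes "x \<epsilon> F" "y \<epsilon> F" "same_code x y"
  shows "x = y"
proof (rule group.sign_itinerary_injective[of u same_code])
  show "rel l x zero \<longleftrightarrow> rel l y zero"
    if "x \<in> {x. x \<epsilon> F}" "y \<in> {x. x \<epsilon> F}" "same_code x y" for x y
    using that code_a_iff[of x] code_a_iff[of y] a_in_Z unfolding same_code_def by simp
  show "same_code (step x) (step y)"
    if "x \<in> {x. x \<epsilon> F}" "y \<in> {x. x \<epsilon> F}" "same_code x y" for x y
    using that code_\<phi>_iff[of x] code_\<phi>_iff[of y] Z_closed unfolding same_code_def by simp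
  have "definable E (\<lambda>e. \<exists>x y. x \<epsilon> F \<and> y \<epsilon> F \<and> \<not> rel l x zero \<and> rel l x u \<and> \<not> rel l y zero \<and>
      rel l y u \<and> same_code x y \<and> is_op E p x (e 0) y)"
    unfolding code_defs by (intro definable_intros)
  from separation_ax[OF this, of F] obtain s where "\<And>d. d \<epsilon> s \<longleftrightarrow> d \<epsilon> F \<and>
      (\<exists>x y. x \<epsilon> F \<and> y \<epsilon> F \<and> \<not> rel l x zero \<and> rel l x u \<and> \<not> rel l y zero \<and> rel l y u \<and>
        same_code x y \<and> is_op E p x d y)" by blast
  then show "{d \<in> {x. x \<epsilon> F}. \<exists>x\<in>{x. x \<epsilon> F}. \<exists>y\<in>{x. x \<epsilon> F}. \<not> rel l x zero \<and> rel l x u \<and>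
      \<not> rel l y zero \<and> rel l y u \<and> same_code x y \<and> plus x d = y} \<in> range (\<lambda>s. {x. x \<epsilon> s})"
    using op_iff by (intro image_eqI[of _ _ s]) auto
  have "definable E (\<lambda>e. rel l (e 0) zero \<and> (\<exists>y. y \<epsilon> F \<and> same_code (e 0) y \<and> e 0 \<noteq> y))"
    unfolding code_defs by (intro definable_intros)
  from separation_ax[OF this, of F] obtain s where "\<And>x. x \<epsilon> s \<longleftrightarrow> x \<epsilon> F \<and>
      rel l x zero \<and> (\<exists>y. y \<epsilon> F \<and> same_code x y \<and> x \<noteq> y)" by blast
  then show "{x \<in> {x. x \<epsilon> F}. rel l x zero \<and> (\<exists>y\<in>{x. x \<epsilon> F}. same_code x y \<and> x \<noteq> y)}
      \<in> range (\<lambda>s. {x. x \<epsilon> s})"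
    by (intro image_eqI[of _ _ s]) auto
qed (use assms u in \<open>auto simp: same_code_def\<close>)

text \<open>Keeps the successor arrows off the diagonal, where loops are reserved for points outside
  \<open>Z\<close>.\<close>

lemma \<phi>_no_fixpoint: "x \<epsilon> Z \<Longrightarrow> \<phi> x \<noteq> x"
proof -
  assume x: "x \<epsilon> Z"
  then have "\<not> rel f x x"
  proof (rule Z_induct)
    show "definable E (\<lambda>e. \<not> rel f (e 0) (e 0))" by (intro definable_intros)
    show "\<not> rel f a a" using f_iff a_in_A a_not_image[OF a_in_Z] by metis
    show "\<not> rel f (\<phi> x) (\<phi> x)" if "x \<epsilon> Z" "\<not> rel f x x" for x
      using that f_iff \<phi>_inj \<phi>_closed Z_subset by metis
  qed
  then show ?thesis using f_iff x Z_subset by metis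
qed

text \<open>
  The relation makes \<open>Z\<close> definable as the set of irreflexive points, orders \<open>Z\<close> by its successor
  function, and attaches to every point outside \<open>Z\<close> its code as a subset of \<open>Z\<close>.
\<close>

lemma rigid_relation_ex: "\<exists>r. relation_on r A \<and> rigid A r"
proof -
  have "definable E (\<lambda>e. \<not> e 0 \<epsilon> Z \<and> e (Suc 0) = e 0 \<or> e 0 \<epsilon> Z \<and> e (Suc 0) \<epsilon> Z \<and> rel f (e 0) (e (Suc 0))
      \<or> \<not> e 0 \<epsilon> Z \<and> e (Suc 0) \<epsilon> Z \<and> code (e 0) (e (Suc 0)))"
    unfolding code_defs by (intro definable_intros)
  from relation_comprehension[OF this, of A] obtain r
    where r: "\<And>q. q \<epsilon> r \<Longrightarrow> \<exists>x y. x \<epsilon> A \<and> y \<epsilon> A \<and> pair x y q"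
      and r_iff: "\<And>x y. rel r x y \<longleftrightarrow> x \<epsilon> A \<and> y \<epsilon> A \<and> (\<not> x \<epsilon> Z \<and> y = x \<or> x \<epsilon> Z \<and> y \<epsilon> Z \<and> rel f x y
        \<or> \<not> x \<epsilon> Z \<and> y \<epsilon> Z \<and> code x y)" by metis
  have r_Z: "rel r x y \<longleftrightarrow> y = \<phi> x" if "x \<epsilon> Z" "y \<epsilon> Z" for x y
    using that f_iff Z_subset unfolding r_iff by blast
  have r_code: "rel r x y \<longleftrightarrow> code x y" if "x \<epsilon> A" "\<not> x \<epsilon> Z" "y \<epsilon> Z" for x y
    using that Z_subset unfolding r_iff by blast
  have r_refl: "rel r x x \<longleftrightarrow> \<not> x \<epsilon> Z" if "x \<epsilon> A" for x
    using that r_Z[of x x] \<phi>_no_fixpoint[of x] r_iff by metis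
  have "rel g x x" if g: "automorphism g A r" and x: "x \<epsilon> A" for g x
  proof -
    obtain \<sigma> where \<sigma>: "\<And>x w. x \<epsilon> A \<Longrightarrow> rel g x w \<longleftrightarrow> w = \<sigma> x" "\<And>x. x \<epsilon> A \<Longrightarrow> \<sigma> x \<epsilon> A"
      and surj: "\<And>y. y \<epsilon> A \<Longrightarrow> \<exists>x. x \<epsilon> A \<and> y = \<sigma> x"
      and pres: "\<And>x y. x \<epsilon> A \<Longrightarrow> y \<epsilon> A \<Longrightarrow> rel r x y \<longleftrightarrow> rel r (\<sigma> x) (\<sigma> y)"
      using g by (rule automorphismE) blast
    have \<sigma>_Z: "\<sigma> x \<epsilon> Z \<longleftrightarrow> x \<epsilon> Z" if "x \<epsilon> A" for x
      using pres[OF that that] r_refl \<sigma>(2) that by blast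
    \<comment> \<open>Within \<open>Z\<close>, \<open>a\<close> is the only point without
      predecessor. Points outside \<open>Z\<close> may also point at \<open>a\<close>, so the
      predecessor of \<open>\<sigma> a\<close> has to be pulled back inside
      \<open>Z\<close>.\<close>
    have "\<sigma> a = a"
    proof (rule ccontr)
      assume "\<sigma> a \<noteq> a"
      then obtain y where y: "y \<epsilon> Z" "\<sigma> a = \<phi> y" using Z_cases \<sigma>_Z a_in_A a_in_Z by metis
      then obtain x where x: "x \<epsilon> A" "y = \<sigma> x" using surj Z_subset by blast
      then have "x \<epsilon> Z" using \<sigma>_Z y by blast
      moreover have "rel r (\<sigma> x) (\<sigma> a)" using r_Z y x \<sigma>_Z a_in_A a_in_Z by metis
      then have "rel r x a" using pres x a_in_A by blast
      ultimately show False using r_Z[of x a] a_in_Z a_not_image by blast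
    qed
    have fixed: "\<sigma> v = v" if v: "v \<epsilon> Z" for v
    proof -
      have "rel g v v" using v
      proof (rule Z_induct)
        show "definable E (\<lambda>e. rel g (e 0) (e 0))" by (intro definable_intros)
        show "rel g a a" using \<sigma> a_in_A \<open>\<sigma> a = a\<close> by metis
        fix v assume v: "v \<epsilon> Z" "rel g v v"
        then have "\<sigma> v = v" using \<sigma> Z_subset by metis
        \<comment> \<open>Inside \<open>Z\<close>, the point \<open>\<phi> v\<close> is the only one
          that \<open>v\<close> points at.\<close>
        moreover have "rel r v (\<phi> v)" using r_Z v Z_closed by blast
        ultimately have "rel r v (\<sigma> (\<phi> v))" using pres[of v "\<phi> v"] v Z_subset Z_closed by metis
        moreover have "\<sigma> (\<phi> v) \<epsilon> Z" using \<sigma>_Z v Z_closed Z_subset by blast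
        ultimately have "\<sigma> (\<phi> v) = \<phi> v" using r_Z v by blast
        then show "rel g (\<phi> v) (\<phi> v)" using \<sigma> v Z_closed Z_subset by metis
      qed
      then show ?thesis using \<sigma> v Z_subset by metis
    qed
    have "\<sigma> x = x"
    proof (cases "x \<epsilon> Z")
      case False
      have "code x v \<longleftrightarrow> code (\<sigma> x) v" if v: "v \<epsilon> Z" for v
      proof -
        have "rel r x v \<longleftrightarrow> rel r (\<sigma> x) v" using pres[OF x Z_subset[OF v]] fixed[OF v] by simp
        then show ?thesis using r_code x False v \<sigma>_Z \<sigma>(2) by blast
      qed
      then have "same_code x (\<sigma> x)" unfolding same_code_def by blast
      then show ?thesis using same_code_imp_eq x \<sigma>(2) A_subset by metis
    qed (rule fixed)
    then show ?thesis using \<sigma> x by metis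
  qed
  then show ?thesis using r unfolding rigid_def relation_on_def by blast
qed

end

section \<open>The two cases for a set of reals\<close>

context complete_group
begin

lemma subset_has_rigid_relation:
  assumes A_subset: "\<And>x. x \<epsilon> A \<Longrightarrow> x \<epsilon> F"
  shows "\<exists>r. relation_on r A \<and> rigid A r"
proof -
  have "definable E (\<lambda>e. rel l (e 0) (e (Suc 0)))" by (intro definable_intros)
  from relation_comprehension[OF this, of A] obtain r
    where r: "\<And>q. q \<epsilon> r \<Longrightarrow> \<exists>x y. x \<epsilon> A \<and> y \<epsilon> A \<and> pair x y q"
      and r_iff: "\<And>x y. rel r x y \<longleftrightarrow> x \<epsilon> A \<and> y \<epsilon> A \<and> rel l x y" by metis
  show ?thesis
  proof (cases "rigid A r")
    case True
    then show ?thesis using r unfolding relation_on_def by blast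
  next
    case False
    then obtain f a where f: "automorphism f A r" and a: "a \<epsilon> A" "\<not> rel f a a"
      unfolding rigid_def by blast
    obtain \<phi> where \<phi>: "\<And>x w. x \<epsilon> A \<Longrightarrow> rel f x w \<longleftrightarrow> w = \<phi> x" "\<And>x. x \<epsilon> A \<Longrightarrow> \<phi> x \<epsilon> A"
      "\<And>x y. x \<epsilon> A \<Longrightarrow> y \<epsilon> A \<Longrightarrow> \<phi> x = \<phi> y \<Longrightarrow> x = y"
      and "\<And>x y. x \<epsilon> A \<Longrightarrow> y \<epsilon> A \<Longrightarrow> rel r x y \<longleftrightarrow> rel r (\<phi> x) (\<phi> y)"
      using f by (rule automorphismE) blast
    then have mono: "rel l (\<phi> x) (\<phi> y)" if "x \<epsilon> A" "y \<epsilon> A" "rel l x y" for x y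
      using that r_iff by blast
    have "definable E (\<lambda>e. \<forall>X. a \<epsilon> X \<and> (\<forall>y w. y \<epsilon> A \<and> y \<epsilon> X \<and> rel f y w \<longrightarrow> w \<epsilon> X) \<longrightarrow> e 0 \<epsilon> X)"
      by (intro definable_intros)
    from separation_ax[OF this, of A] obtain Z where Z: "\<And>x. x \<epsilon> Z \<longleftrightarrow> x \<epsilon> A \<and>
      (\<forall>X. a \<epsilon> X \<and> (\<forall>y w. y \<epsilon> A \<and> y \<epsilon> X \<and> rel f y w \<longrightarrow> w \<epsilon> X) \<longrightarrow> x \<epsilon> X)" by blast
    interpret orbit E A f a Z \<phi>
      using \<phi> a Z by unfold_locales
    obtain u where u: "u \<epsilon> F" "rel l zero u" using positive_ex by blast
    define b where "b = \<phi> a"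
    have b: "b \<epsilon> A" "b \<noteq> a" using \<phi> a unfolding b_def by metis+
    \<comment> \<open>Since \<phi> preserves the order, the orbit stays on the side of
      \<open>a\<close> to which the first move leads. One induction covers both directions, with the
      value \<open>b\<close> of that move as a parameter.\<close>
    have "\<phi> x \<noteq> a" if x: "x \<epsilon> Z" for x
    proof -
      have "\<forall>w. rel f x w \<longrightarrow> (rel l a b \<longrightarrow> rel l a w) \<and> (rel l b a \<longrightarrow> rel l w a)" using x
      proof (rule Z_induct)
        show "definable E (\<lambda>e. \<forall>w. rel f (e 0) w \<longrightarrow>
            (rel l a b \<longrightarrow> rel l a w) \<and> (rel l b a \<longrightarrow> rel l w a))"
          by (intro definable_intros)
        show "\<forall>w. rel f a w \<longrightarrow> (rel l a b \<longrightarrow> rel l a w) \<and> (rel l b a \<longrightarrow> rel l w a)"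
          using \<phi>(1)[OF a(1)] unfolding b_def by simp
        fix x assume x: "x \<epsilon> Z"
          and *: "\<forall>w. rel f x w \<longrightarrow> (rel l a b \<longrightarrow> rel l a w) \<and> (rel l b a \<longrightarrow> rel l w a)"
        have A: "x \<epsilon> A" "\<phi> x \<epsilon> A" "\<phi> (\<phi> x) \<epsilon> A" using x Z_subset \<phi>(2) by blast+
        have "rel l a (\<phi> (\<phi> x))" if "rel l a b"
        proof -
          have "rel l a (\<phi> x)" using * that \<phi>(1)[OF A(1)] by simp
          then have "rel l b (\<phi> (\<phi> x))" using mono a A unfolding b_def by blast
          then show ?thesis using l_trans that A_subset a b A by blast
        qed
        moreover have "rel l (\<phi> (\<phi> x)) a" if "rel l b a"
        proof -
          have "rel l (\<phi> x) a" using * that \<phi>(1)[OF A(1)] by simp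
          then have "rel l (\<phi> (\<phi> x)) b" using mono a A unfolding b_def by blast
          then show ?thesis using l_trans that A_subset a b A by blast
        qed
        ultimately show "\<forall>w. rel f (\<phi> x) w \<longrightarrow>
            (rel l a b \<longrightarrow> rel l a w) \<and> (rel l b a \<longrightarrow> rel l w a)"
          using \<phi>(1)[OF A(2)] by simp
      qed
      moreover have "rel l a b \<or> rel l b a" using l_total[of a b] A_subset a b by blast
      ultimately show ?thesis using \<phi>(1)[OF Z_subset[OF x]] l_irrefl A_subset a by metis
    qed
    then interpret coding E F p zero l A f a Z \<phi> u
      using A_subset u by unfold_locales
    show ?thesis by (rule rigid_relation_ex)
  qed
qed

end

section \<open>From the formulas to the locales\<close>

context zf_model
begin

lemma complete_group:
  assumes field: "sat E e (ordered_field_fm F p m z u l)" and complete: "sat E e (complete_fm F l)"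
  shows "complete_group E (e F) (e p) (e z) (e l)"
proof -
  have "sat E e (field_fm F p m z u)" "sat E e (linorder_fm F l)"
    using field unfolding sat_ordered_field by blast+
  note facts = this[unfolded sat_field sat_linorder]
  have assoc: "\<exists>xy yz w. xy \<epsilon> e F \<and> yz \<epsilon> e F \<and> w \<epsilon> e F \<and>
      is_op E (e p) x y xy \<and> is_op E (e p) y z yz \<and> is_op E (e p) xy z w \<and> is_op E (e p) x yz w"
    if "x \<epsilon> e F" "y \<epsilon> e F" "z \<epsilon> e F" for x y z
    using facts(1) that unfolding sat_assoc by blast
  show ?thesis
  proof
    show "\<exists>w. w \<epsilon> e F \<and> (\<forall>v. is_op E (e p) x y v \<longleftrightarrow> v = w)" if "x \<epsilon> e F" "y \<epsilon> e F" for x y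
    proof -
      \<comment> \<open>Uniqueness does not say where the value lies. The witness \<open>xy\<close>
        of associativity, taken with \<open>x\<close> as third factor, is the same value and lies in
        the field.\<close>
      have "\<exists>w. \<forall>v. is_op E (e p) x y v \<longleftrightarrow> v = w"
        using facts(1) that unfolding sat_binop by blast
      then show ?thesis using assoc[OF that that(1)] by metis
    qed
    show "\<exists>xy yz w. xy \<epsilon> e F \<and> yz \<epsilon> e F \<and> w \<epsilon> e F \<and>
      is_op E (e p) x y xy \<and> is_op E (e p) y z yz \<and> is_op E (e p) xy z w \<and> is_op E (e p) x yz w"
      if "x \<epsilon> e F" "y \<epsilon> e F" "z \<epsilon> e F" for x y z using assoc that .
    show "is_op E (e p) y x z"
      if "x \<epsilon> e F" "y \<epsilon> e F" "z \<epsilon> e F" "is_op E (e p) x y z" for x y z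
      using facts(1) that unfolding sat_comm by blast
    show "is_op E (e p) (e z) x x" if "x \<epsilon> e F" for x
      using facts(1) that unfolding sat_neutral by blast
    show "rel (e l) s t"
      if "x \<epsilon> e F" "y \<epsilon> e F" "c \<epsilon> e F" "s \<epsilon> e F" "t \<epsilon> e F" "rel (e l) x y"
        "is_op E (e p) x c s" "is_op E (e p) y c t" for x y c s t
      using field that unfolding sat_ordered_field by blast
    show "\<exists>b. b \<epsilon> e F \<and> (\<forall>x. x \<epsilon> s \<longrightarrow> rel (e l) x b \<or> x = b) \<and>
        (\<forall>c. c \<epsilon> e F \<and> (\<forall>x. x \<epsilon> s \<longrightarrow> rel (e l) x c \<or> x = c) \<longrightarrow> rel (e l) b c \<or> b = c)"
      if "\<forall>x. x \<epsilon> s \<longrightarrow> x \<epsilon> e F" "\<exists>x. x \<epsilon> s"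
        "\<exists>b. b \<epsilon> e F \<and> (\<forall>x. x \<epsilon> s \<longrightarrow> rel (e l) x b \<or> x = b)" for s
      using complete that unfolding sat_complete by blast
  qed (use facts in metis)+
qed

lemma sat_relation_on_iff: "sat E e (relation_on_fm r A) \<longleftrightarrow> relation_on (e r) (e A)"
  unfolding sat_relation_on relation_on_def ..

lemma sat_rigid_iff: "sat E e (rigid_fm A r) \<longleftrightarrow> rigid (e A) (e r)"
  unfolding sat_rigid rigid_def sat_automorphism sat_bij sat_relation_on_iff automorphism_def
  by simp

lemma sat_sets_of_reals_admit_rigid_relations: "sat E e sets_of_reals_admit_rigid_relations"
proof -
  have "\<exists>r. relation_on r A \<and> rigid A r"
    if reals: "sat E e (reals_fm 0)" and A: "\<And>x. x \<epsilon> A \<Longrightarrow> x \<epsilon> e 0" for e A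
  proof -
    from reals obtain p m z u l where
      "sat E (case_nat l (case_nat u (case_nat z (case_nat m (case_nat p e)))))
        (ordered_field_fm 5 4 3 2 1 0)"
      "sat E (case_nat l (case_nat u (case_nat z (case_nat m (case_nat p e))))) (complete_fm 5 0)"
      unfolding reals_fm_def by auto
    from complete_group[OF this] have "complete_group E (e 0) p z l"
      by (simp add: eval_nat_numeral)
    then show ?thesis by (rule complete_group.subset_has_rigid_relation) (rule A)
  qed
  then show ?thesis
    by (simp add: sets_of_reals_admit_rigid_relations_def sat_subset sat_relation_on_iff
        sat_rigid_iff)
qed

end

section \<open>The theorem\<close>

text \<open>
  The semantics quantifies over a whole type, so the term model of a Henkin set has to be a type. It is
  built from a Henkin set that would exist if the theorem were not provable; otherwise \<open>SOME\<close> yields an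
  arbitrary set, which still gives a nonempty type.
\<close>

definition refuting_henkin_set :: "fm set" where
  "refuting_henkin_set =
    (SOME U. insert (\<^bold>\<not> sets_of_reals_admit_rigid_relations) ZF \<subseteq> U \<and> henkin U)"

typedef term_model = "range (\<lambda>x. {y. (x \<^bold>= y) \<in> refuting_henkin_set})"
  by blast

theorem theorem1: "ZF \<turnstile> sets_of_reals_admit_rigid_relations"
proof (rule ccontr)
  let ?\<phi> = "sets_of_reals_admit_rigid_relations" and ?U = refuting_henkin_set
  assume "\<not> (ZF \<turnstile> ?\<phi>)"
  then have "\<not> (insert (\<^bold>\<not> ?\<phi>) ZF \<turnstile> \<^bold>\<bottom>)" using Classical by blast
  then have "\<exists>U. insert (\<^bold>\<not> ?\<phi>) ZF \<subseteq> U \<and> henkin U"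
    by (rule henkin_extension) (auto simp: arity_ZF arity_sets_of_reals_admit_rigid_relations)
  then have U: "insert (\<^bold>\<not> ?\<phi>) ZF \<subseteq> ?U" "henkin ?U"
    unfolding refuting_henkin_set_def by (metis (mono_tags, lifting) someI_ex)+
  define h where "h x = Abs_term_model {y. (x \<^bold>= y) \<in> ?U}" for x
  define E where "E a b \<longleftrightarrow> (\<exists>x y. a = h x \<and> b = h y \<and> (x \<^bold>\<in> y) \<in> ?U)" for a b
  have "surj h"
    unfolding surj_def
  proof
    show "\<exists>x. b = h x" for b by (cases b) (auto simp: h_def)
  qed
  moreover have "h x = h y \<longleftrightarrow> (x \<^bold>= y) \<in> ?U" for x y
    unfolding h_def henkin_eq_iff[OF U(2), of x y] by (rule Abs_term_model_inject) auto
  \<comment> \<open>The identity renaming: every variable is interpreted by its own class.\<close>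
  ultimately have sat_iff: "sat E h p \<longleftrightarrow> p \<in> ?U" for p
    using henkin_model[OF U(2), of h "\<lambda>n. n" p] unfolding E_def[abs_def] by simp
  have "zf_model E" by (rule zf_model) (use sat_iff U(1) in blast)
  then have "sat E h ?\<phi>" by (rule zf_model.sat_sets_of_reals_admit_rigid_relations)
  moreover have "sat E h (\<^bold>\<not> ?\<phi>)" using sat_iff U(1) by blast
  ultimately show False by simp
qed

end
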